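(* Let $n\ge 1$. For any state $s$ of the free MV-algebra $\mathbf{F}_n$ the following conditions are equivalent: (1) $s$ is a faithful state; (2) there exists a unique strictly positive, regular Borel probability measure $\mu_s$ on $[0,1]^n$ such that for every $f\in\mathbf{F}_n$, $$s(f)=\int_{[0,1]^n}f\,\mathrm{d}\mu_s.$$ Moreover, the correspondence between faithful states of $\mathbf{F}_n$ and strictly positive, regular Borel probability measures on $[0,1]^n$ is one-one.
   Context: $\mathbf{F}_n$ is the free $n$-generated MV-algebra, identified with the algebra of all $n$-variable McNaughton functions: continuous functions $f:[0,1]^n\to[0,1]$ that are piecewise linear (affine) with finitely many pieces, each piece having integer coefficients. The operations are pointwise, with $x\oplus y=\min\{1,x+y\}$, $\neg x=1-x$, $x\odot y=\max\{0,x+y-1\}$ on $[0,1]$; $0$ and $1$ are the constant functions. A state of an MV-algebra $\mathbf{A}$ is a map $s:A\to[0,1]$ with $s(1)=1$ and $s(a\oplus b)=s(a)+s(b)$ whenever $a\odot b=0$. A state $s$ is faithful if $s(a)\neq 0$ for all $a\neq 0$. A regular Borel measure $\mu$ on $[0,1]^n$ is strictly positive if $\mu(O)>0$ for every nonempty open $O\subseteq[0,1]^n$. *)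

theory Defs
  imports "HOL-Probability.Probability"
begin

section \<open>MV-algebras and states\<close>

record 'a mv_alg =
  mv_carrier :: "'a set"
  mv_oplus :: "'a \<Rightarrow> 'a \<Rightarrow> 'a"
  mv_neg :: "'a \<Rightarrow> 'a"
  mv_zero :: "'a"

definition mv_one :: "'a mv_alg \<Rightarrow> 'a" where
  "mv_one A = mv_neg A (mv_zero A)"

definition mv_odot :: "'a mv_alg \<Rightarrow> 'a \<Rightarrow> 'a \<Rightarrow> 'a" where
  "mv_odot A x y = mv_neg A (mv_oplus A (mv_neg A x) (mv_neg A y))"

locale mv_algebra =
  fixes A :: "'a mv_alg"
  assumes zero_closed: "mv_zero A \<in> mv_carrier A"
    and neg_closed: "x \<in> mv_carrier A \<Longrightarrow> mv_neg A x \<in> mv_carrier A"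
    and oplus_closed:
      "\<lbrakk>x \<in> mv_carrier A; y \<in> mv_carrier A\<rbrakk> \<Longrightarrow> mv_oplus A x y \<in> mv_carrier A"
    and oplus_assoc:
      "\<lbrakk>x \<in> mv_carrier A; y \<in> mv_carrier A; z \<in> mv_carrier A\<rbrakk>
        \<Longrightarrow> mv_oplus A (mv_oplus A x y) z = mv_oplus A x (mv_oplus A y z)"
    and oplus_commute:
      "\<lbrakk>x \<in> mv_carrier A; y \<in> mv_carrier A\<rbrakk> \<Longrightarrow> mv_oplus A x y = mv_oplus A y x"
    and oplus_zero: "x \<in> mv_carrier A \<Longrightarrow> mv_oplus A x (mv_zero A) = x"
    and neg_neg: "x \<in> mv_carrier A \<Longrightarrow> mv_neg A (mv_neg A x) = x"
    and oplus_one: "x \<in> mv_carrier A \<Longrightarrow> mv_oplus A x (mv_one A) = mv_one A"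
    and lukasiewicz:
      "\<lbrakk>x \<in> mv_carrier A; y \<in> mv_carrier A\<rbrakk>
        \<Longrightarrow> mv_oplus A (mv_neg A (mv_oplus A (mv_neg A x) y)) y
          = mv_oplus A (mv_neg A (mv_oplus A (mv_neg A y) x)) x"

text \<open>States are extensional (\<open>undefined\<close> off the carrier), so that equality of states is
  equality as maps on the algebra.\<close>

definition mv_state :: "'a mv_alg \<Rightarrow> ('a \<Rightarrow> real) \<Rightarrow> bool" where
  "mv_state A s \<longleftrightarrow>
     s \<in> mv_carrier A \<rightarrow>\<^sub>E {0..1} \<and>
     s (mv_one A) = 1 \<and>
     (\<forall>a\<in>mv_carrier A. \<forall>b\<in>mv_carrier A.
        mv_odot A a b = mv_zero A \<longrightarrow> s (mv_oplus A a b) = s a + s b)"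

definition faithful_mv_state :: "'a mv_alg \<Rightarrow> ('a \<Rightarrow> real) \<Rightarrow> bool" where
  "faithful_mv_state A s \<longleftrightarrow>
     mv_state A s \<and> (\<forall>a\<in>mv_carrier A. a \<noteq> mv_zero A \<longrightarrow> s a \<noteq> 0)"


section \<open>The algebra of McNaughton functions\<close>

abbreviation unit_cube :: "(real ^ 'n) set" where
  "unit_cube \<equiv> cbox 0 1"

definition int_affine :: "(real ^ 'n \<Rightarrow> real) set" where
  "int_affine = {p. \<exists>(a :: 'n \<Rightarrow> int) (b :: int).
     p = (\<lambda>x. (\<Sum>i\<in>UNIV. of_int (a i) * x $ i) + of_int b)}"

text \<open>A McNaughton function coincides at each point of the cube with one of finitely many affine
  functions with integer coefficients. Functions on the cube are represented extensionally.\<close>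

definition mcnaughton :: "(real ^ 'n \<Rightarrow> real) set" where
  "mcnaughton = {f. f \<in> unit_cube \<rightarrow>\<^sub>E {0..1} \<and>
     continuous_on unit_cube f \<and>
     (\<exists>P. finite P \<and> P \<subseteq> int_affine \<and> (\<forall>x\<in>unit_cube. \<exists>p\<in>P. f x = p x))}"

definition free_mv :: "(real ^ 'n \<Rightarrow> real) mv_alg" where
  "free_mv =
     \<lparr> mv_carrier = mcnaughton,
       mv_oplus = (\<lambda>f g. \<lambda>x\<in>unit_cube. min 1 (f x + g x)),
       mv_neg = (\<lambda>f. \<lambda>x\<in>unit_cube. 1 - f x),
       mv_zero = (\<lambda>x\<in>unit_cube. 0) \<rparr>"

lemma mv_one_free_mv: "mv_one free_mv = (\<lambda>x\<in>unit_cube. 1)"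
  by (auto simp: mv_one_def free_mv_def)

lemma mv_odot_free_mv:
  "mv_odot free_mv f g = (\<lambda>x\<in>unit_cube. max 0 (f x + g x - 1))"
  by (auto simp: mv_odot_def free_mv_def fun_eq_iff)

lemma int_affine_const: "(\<lambda>x. of_int b) \<in> int_affine"
  unfolding int_affine_def by (auto intro!: exI[of _ "\<lambda>_. 0"] exI[of _ b])

lemma int_affine_add:
  assumes "p \<in> int_affine" "q \<in> int_affine"
  shows "(\<lambda>x. p x + q x) \<in> int_affine"
proof -
  obtain a b c d where "p = (\<lambda>x. (\<Sum>i\<in>UNIV. of_int (a i) * x $ i) + of_int b)"
    "q = (\<lambda>x. (\<Sum>i\<in>UNIV. of_int (c i) * x $ i) + of_int d)"
    using assms unfolding int_affine_def by blast
  then show ?thesis unfolding int_affine_def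
    by (auto intro!: exI[of _ "\<lambda>i. a i + c i"] exI[of _ "b + d"]
        simp: fun_eq_iff algebra_simps sum.distrib)
qed

lemma int_affine_neg:
  assumes "p \<in> int_affine"
  shows "(\<lambda>x. 1 - p x) \<in> int_affine"
proof -
  obtain a b where "p = (\<lambda>x. (\<Sum>i\<in>UNIV. of_int (a i) * x $ i) + of_int b)"
    using assms unfolding int_affine_def by blast
  then show ?thesis unfolding int_affine_def
    by (auto intro!: exI[of _ "\<lambda>i. - a i"] exI[of _ "1 - b"]
        simp: fun_eq_iff algebra_simps sum_negf)
qed

lemma mcnaughton_zero: "(\<lambda>x\<in>unit_cube. 0) \<in> mcnaughton"
  using int_affine_const[of 0]
  by (auto simp: mcnaughton_def intro!: exI[of _ "{\<lambda>x. 0}"] cong: continuous_on_cong_simp)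

lemma mcnaughton_neg:
  assumes "f \<in> mcnaughton"
  shows "(\<lambda>x\<in>unit_cube. 1 - f x) \<in> mcnaughton"
proof -
  obtain P where P: "finite P" "P \<subseteq> int_affine" "\<forall>x\<in>unit_cube. \<exists>p\<in>P. f x = p x"
    using assms unfolding mcnaughton_def by blast
  have "continuous_on unit_cube (\<lambda>x\<in>unit_cube. 1 - f x)"
    using assms by (auto simp: mcnaughton_def intro!: continuous_intros
        cong: continuous_on_cong_simp)
  moreover have "\<exists>Q. finite Q \<and> Q \<subseteq> int_affine \<and>
      (\<forall>x\<in>unit_cube. \<exists>q\<in>Q. (\<lambda>x\<in>unit_cube. 1 - f x) x = q x)"
    using P int_affine_neg by (intro exI[of _ "(\<lambda>p x. 1 - p x) ` P"]) force
  ultimately show ?thesis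
    using assms by (auto simp: mcnaughton_def PiE_iff)
qed

lemma mcnaughton_oplus:
  assumes "f \<in> mcnaughton" "g \<in> mcnaughton"
  shows "(\<lambda>x\<in>unit_cube. min 1 (f x + g x)) \<in> mcnaughton"
proof -
  obtain P where P: "finite P" "P \<subseteq> int_affine" "\<forall>x\<in>unit_cube. \<exists>p\<in>P. f x = p x"
    using assms unfolding mcnaughton_def by blast
  obtain Q where Q: "finite Q" "Q \<subseteq> int_affine" "\<forall>x\<in>unit_cube. \<exists>q\<in>Q. g x = q x"
    using assms unfolding mcnaughton_def by blast
  define R where "R = insert (\<lambda>x. 1) ((\<lambda>(p, q) x. p x + q x) ` (P \<times> Q))"
  have "continuous_on unit_cube (\<lambda>x\<in>unit_cube. min 1 (f x + g x))"
    using assms by (auto simp: mcnaughton_def intro!: continuous_intros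
        cong: continuous_on_cong_simp)
  moreover have "finite R" "R \<subseteq> int_affine"
    using P(1,2) Q(1,2) int_affine_const[of 1] by (auto simp: R_def intro!: int_affine_add)
  moreover have "\<exists>r\<in>R. (\<lambda>x\<in>unit_cube. min 1 (f x + g x)) x = r x" if "x \<in> unit_cube" for x
  proof -
    obtain p q where "p \<in> P" "q \<in> Q" "f x = p x" "g x = q x"
      using P(3) Q(3) \<open>x \<in> unit_cube\<close> by meson
    then have "(\<lambda>x. p x + q x) \<in> R" "(\<lambda>x. 1) \<in> R"
      by (auto simp: R_def)
    with \<open>f x = p x\<close> \<open>g x = q x\<close> that show ?thesis
      by (cases "f x + g x \<le> 1") force+
  qed
  ultimately show ?thesis
    using assms by (auto simp: mcnaughton_def PiE_iff)
qed

lemma mv_algebra_free_mv: "mv_algebra free_mv"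
proof
qed (auto simp: free_mv_def mv_one_def mcnaughton_zero mcnaughton_neg mcnaughton_oplus,
  auto simp: mcnaughton_def fun_eq_iff PiE_iff extensional_def min_def)


section \<open>Measures\<close>

definition borel_measure_on :: "'a::topological_space set \<Rightarrow> 'a measure \<Rightarrow> bool" where
  "borel_measure_on X M \<longleftrightarrow> sets M = sets (restrict_space borel X)"

definition regular_on :: "'a::topological_space set \<Rightarrow> 'a measure \<Rightarrow> bool" where
  "regular_on X M \<longleftrightarrow> (\<forall>B\<in>sets M.
     emeasure M B = (SUP K\<in>{K. compact K \<and> K \<subseteq> B}. emeasure M K) \<and>
     emeasure M B = (INF U\<in>{U. openin (top_of_set X) U \<and> B \<subseteq> U}. emeasure M U))"

definition strictly_positive_on :: "'a::topological_space set \<Rightarrow> 'a measure \<Rightarrow> bool" where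
  "strictly_positive_on X M \<longleftrightarrow>
     (\<forall>U. openin (top_of_set X) U \<and> U \<noteq> {} \<longrightarrow> emeasure M U > 0)"

definition strictly_positive_prob_measures :: "(real ^ 'n) measure set" where
  "strictly_positive_prob_measures = {M. borel_measure_on unit_cube M \<and> prob_space M \<and>
     regular_on unit_cube M \<and> strictly_positive_on unit_cube M}"

definition represents :: "(real ^ 'n) measure \<Rightarrow> ((real ^ 'n \<Rightarrow> real) \<Rightarrow> real) \<Rightarrow> bool" where
  "represents M s \<longleftrightarrow> (\<forall>f\<in>mv_carrier free_mv. s f = (\<integral>x. f x \<partial>M))"

definition state_measure :: "((real ^ 'n \<Rightarrow> real) \<Rightarrow> real) \<Rightarrow> (real ^ 'n) measure" where
  "state_measure s = (THE M. M \<in> strictly_positive_prob_measures \<and> represents M s)"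

end

theory Submission
  imports Defs
begin

text \<open>A state of an MV-algebra of continuous functions on a compact space is integration against a
  measure, by Daniell's construction. By Riesz decomposition the state is monotone on finite sums,
  hence by Dini's theorem on countable ones, so \<open>A \<mapsto> inf {\<Sum> s (g i) | \<Sum> g i \<ge> 1 on A}\<close> is an outer
  measure for which the sets \<open>{f > 0}\<close> are Caratheodory measurable, with
  \<open>\<mu> {f = 1} \<le> s f \<le> \<mu> {f > 0}\<close>. Writing \<open>k f\<close> as the sum of its slices \<open>min 1 (max 0 (k f - j))\<close>
  and applying these bounds to each slice gives \<open>\<bar>s f - \<integral> f\<bar> \<le> 1 / k\<close>.
  The measure is unique because the sets \<open>{f > 0}\<close> form an intersection-stable generator of the
  Borel sets whose measure is the limit of \<open>\<integral> min 1 (k f)\<close>. These sets also form a base of the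
  topology of the cube, so faithfulness means exactly that nonempty open sets have positive measure.\<close>

section \<open>MV-algebras of continuous functions\<close>

text \<open>Members of \<open>L\<close> are total functions with arbitrary values off
  \<open>X\<close>; \<open>L_cong\<close> makes membership depend on \<open>X\<close> alone, so
  pointwise lambda terms can be used without restricting them.\<close>

locale mv_functions =
  fixes X :: "'a::topological_space set" and L :: "('a \<Rightarrow> real) set"
  assumes compact_X: "compact X"
    and cont: "f \<in> L \<Longrightarrow> continuous_on X f"
    and nonneg: "\<lbrakk>f \<in> L; x \<in> X\<rbrakk> \<Longrightarrow> 0 \<le> f x"
    and le_one: "\<lbrakk>f \<in> L; x \<in> X\<rbrakk> \<Longrightarrow> f x \<le> 1"
    and L_cong: "\<lbrakk>f \<in> L; \<And>x. x \<in> X \<Longrightarrow> f x = g x\<rbrakk> \<Longrightarrow> g \<in> L"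
    and one: "(\<lambda>x. 1) \<in> L"
    and compl: "f \<in> L \<Longrightarrow> (\<lambda>x. 1 - f x) \<in> L"
    and oplus: "\<lbrakk>f \<in> L; g \<in> L\<rbrakk> \<Longrightarrow> (\<lambda>x. min 1 (f x + g x)) \<in> L"
begin

lemma zero: "(\<lambda>x. 0) \<in> L"
  using compl[OF one] by simp

lemma odot:
  assumes "f \<in> L" "g \<in> L"
  shows "(\<lambda>x. max 0 (f x + g x - 1)) \<in> L"
proof -
  have "(\<lambda>x. 1 - min 1 ((1 - f x) + (1 - g x))) \<in> L"
    by (rule compl[OF oplus[OF compl[OF assms(1)] compl[OF assms(2)]]])
  then show ?thesis by (rule L_cong) (auto simp: min_def max_def)
qed

lemma pos_diff: "\<lbrakk>f \<in> L; g \<in> L\<rbrakk> \<Longrightarrow> (\<lambda>x. max 0 (f x - g x)) \<in> L"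
  by (rule L_cong[OF odot[OF _ compl]]) (auto simp: max_def)

lemma diff:
  assumes "f \<in> L" "g \<in> L" "\<And>x. x \<in> X \<Longrightarrow> g x \<le> f x"
  shows "(\<lambda>x. f x - g x) \<in> L"
  by (rule L_cong[OF pos_diff[OF assms(1,2)]]) (use assms(3) in \<open>auto simp: max_def\<close>)

lemma min_L:
  assumes "f \<in> L" "g \<in> L"
  shows "(\<lambda>x. min (f x) (g x)) \<in> L"
proof -
  have "(\<lambda>x. max 0 (f x - max 0 (f x - g x))) \<in> L"
    by (rule pos_diff[OF assms(1) pos_diff[OF assms]])
  then show ?thesis
    by (rule L_cong) (use nonneg[OF assms(1)] nonneg[OF assms(2)] in \<open>auto simp: max_def min_def\<close>)
qed

lemma truncated_sum:
  fixes g :: "nat \<Rightarrow> 'a \<Rightarrow> real"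
  assumes "\<And>i. g i \<in> L"
  shows "(\<lambda>x. min 1 (\<Sum>i<n. g i x)) \<in> L"
proof (induction n)
  case 0
  then show ?case using zero by simp
next
  case (Suc n)
  show ?case
    by (rule L_cong[OF oplus[OF Suc assms[of n]]])
      (use nonneg[OF assms[of n]] in \<open>force simp: min_def\<close>)
qed

text \<open>The layer of \<open>k f\<close> between heights \<open>j\<close> and
  \<open>j + 1\<close>, moved down to 0. The index is an integer because the recursion behind
  membership in \<open>L\<close> lowers \<open>j\<close> at each step, past zero.\<close>

definition slice :: "nat \<Rightarrow> int \<Rightarrow> ('a \<Rightarrow> real) \<Rightarrow> 'a \<Rightarrow> real" where
  "slice k j f x = min 1 (max 0 (of_nat k * f x - of_int j))"

lemma slice_mem:
  assumes f: "f \<in> L"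
  shows "slice k j f \<in> L"
proof (induction k arbitrary: j)
  case 0
  show ?case
  proof (cases "j < 0")
    case True
    then have "real_of_int j \<le> -1" by linarith
    then have "slice 0 j f x = 1" for x by (auto simp: slice_def max_def min_def)
    then show ?thesis using L_cong[OF one] by metis
  next
    case False
    then have "slice 0 j f x = 0" for x by (auto simp: slice_def max_def min_def)
    then show ?thesis using L_cong[OF zero] by metis
  qed
next
  case (Suc k)
  \<comment> \<open>McNaughton's identity: with \<open>c t = min 1 (max 0 t)\<close> and \<open>0 \<le> a \<le> 1\<close>, one has
    \<open>c (y + a) = (c y \<oplus> a) \<odot> c (y + 1)\<close>.\<close>
  have "(\<lambda>x. max 0 (min 1 (slice k j f x + f x) + slice k (j - 1) f x - 1)) \<in> L"
    by (intro odot oplus Suc f)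
  then show ?case
  proof (rule L_cong)
    fix x assume x: "x \<in> X"
    define y where "y = of_nat k * f x - of_int j"
    have "max 0 (min 1 (min 1 (max 0 y) + a) + min 1 (max 0 (y + 1)) - 1) = min 1 (max 0 (y + a))"
      if "0 \<le> a" "a \<le> 1" for a
      using that by (auto simp: max_def min_def)
    from this[OF nonneg[OF f x] le_one[OF f x]]
    show "max 0 (min 1 (slice k j f x + f x) + slice k (j - 1) f x - 1) = slice (Suc k) j f x"
      by (simp add: slice_def y_def algebra_simps)
  qed
qed

lemma slice_eq_one:
  assumes "0 < f x"
  shows "\<exists>n. \<forall>k\<ge>n. slice k 0 f x = 1"
proof -
  obtain n :: nat where n: "1 / f x < n" using reals_Archimedean2 by blast
  have "slice k 0 f x = 1" if "k \<ge> n" for k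
  proof -
    have "1 / f x < k" using n that by linarith
    then show ?thesis using assms by (simp add: slice_def field_simps)
  qed
  then show ?thesis by blast
qed

lemma sum_slices:
  assumes f: "f \<in> L" and x: "x \<in> X"
  shows "(\<Sum>j<k. slice k (int j) f x) = of_nat k * f x"
proof -
  \<comment> \<open>The layers of a single number telescope to its truncation at \<open>m\<close>.
    For \<open>m = k\<close> nothing is cut off, since \<open>f\<close> is at most 1.\<close>
  have *: "(\<Sum>j<m. min 1 (max 0 (y - real j))) = min y (real m)" if "0 \<le> y" for y m
    using that by (induction m) (auto simp: min_def max_def)
  have "of_nat k * f x \<le> of_nat k"
    using le_one[OF f x] by (simp add: mult_left_le)
  then show ?thesis
    using *[of "of_nat k * f x" k] nonneg[OF f x] by (simp add: slice_def)
qed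

text \<open>No closure is taken: this is the relatively open set where \<open>f\<close> is positive,
  not the topological support.\<close>

definition supp :: "('a \<Rightarrow> real) \<Rightarrow> 'a set" where
  "supp f = {x \<in> X. 0 < f x}"

lemma supp_subset: "supp f \<subseteq> X"
  by (auto simp: supp_def)

lemma supp_Inter:
  assumes "finite I" "\<And>i. i \<in> I \<Longrightarrow> g i \<in> L"
  shows "\<exists>h\<in>L. supp h = X \<inter> (\<Inter>i\<in>I. supp (g i))"
  using assms
proof (induction I rule: finite_induct)
  case empty
  then show ?case using one by (intro bexI[of _ "\<lambda>x. 1"]) (simp_all add: supp_def)
next
  case (insert i I)
  then obtain h where "h \<in> L" "supp h = X \<inter> (\<Inter>i\<in>I. supp (g i))" by auto
  then show ?case using insert.prems
    by (intro bexI[OF _ min_L[of "g i" h]]) (auto simp: supp_def)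
qed

lemma openin_supp:
  assumes "f \<in> L"
  shows "openin (top_of_set X) (supp f)"
  using continuous_openin_preimage_gen[OF cont[OF assms] open_greaterThan[of 0]]
  by (simp add: supp_def vimage_def Int_def)

lemma Int_stable_supp: "Int_stable (supp ` L)"
proof (rule Int_stableI_image)
  fix f g assume "f \<in> L" "g \<in> L"
  then show "\<exists>h\<in>L. supp f \<inter> supp g = supp h"
    by (intro bexI[OF _ min_L[of f g]]) (auto simp: supp_def)
qed

section \<open>Measurability and integration over the generated sigma-algebra\<close>

definition supp_sigma :: "'a set set" where
  "supp_sigma = sigma_sets X (supp ` L)"

lemma space_eq: "sets M = supp_sigma \<Longrightarrow> space M = X"
  unfolding supp_sigma_def
  by (metis (no_types, lifting) image_subset_iff sets_measure_of sets_eq_imp_space_eq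
      space_measure_of supp_subset PowI subsetI)

lemma supp_in_sets: "\<lbrakk>sets M = supp_sigma; f \<in> L\<rbrakk> \<Longrightarrow> supp f \<in> sets M"
  by (auto simp: supp_sigma_def)

text \<open>Only positivity at 0 is built into the generators. A point has \<open>a < f x\<close>
  exactly when some fraction \<open>j / k \<ge> a\<close> lies below \<open>f x\<close>, that is,
  when a slice with such indices is positive there; countably many slices suffice.\<close>

lemma measurable:
  assumes M: "sets M = supp_sigma" and f: "f \<in> L"
  shows "f \<in> borel_measurable M"
  unfolding borel_measurable_iff_greater
proof
  fix a :: real
  let ?I = "{(k :: nat, j :: int). 0 < k \<and> a * k \<le> j}"
  have "{x \<in> X. a < f x} = (\<Union>(k, j)\<in>?I. supp (slice k j f))"
  proof (intro equalityI subsetI)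
    fix x assume x: "x \<in> {x \<in> X. a < f x}"
    then obtain q where q: "q \<in> \<rat>" "a < q" "q < f x"
      using Rats_dense_in_real[of a "f x"] by auto
    then obtain j :: int and k :: nat where jk: "0 < k" "q = of_int j / of_nat k"
      unfolding Rats_eq_int_div_nat by auto
    then have "of_int j = q * k" by simp
    then have "a * k \<le> j" "of_int j < of_nat k * f x"
      using q jk(1) by (simp_all add: mult.commute)
    then show "x \<in> (\<Union>(k, j)\<in>?I. supp (slice k j f))"
      using x jk by (auto simp: supp_def slice_def intro!: exI[of _ k] exI[of _ j])
  next
    fix x assume "x \<in> (\<Union>(k, j)\<in>?I. supp (slice k j f))"
    then obtain k j where kj: "0 < k" "a * real k \<le> real_of_int j" "x \<in> supp (slice k j f)"
      by auto
    then have "of_int j < of_nat k * f x" "x \<in> X"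
      by (auto simp: supp_def slice_def max_def min_def split: if_splits)
    then have "a * k < of_nat k * f x" "x \<in> X" using kj(2) by auto
    moreover from this(1) have "a < f x" using kj(1) by (simp add: mult.commute)
    ultimately show "x \<in> {x \<in> X. a < f x}" by simp
  qed
  also have "\<dots> \<in> sets M"
    by (intro sets.countable_UN'') (auto intro!: supp_in_sets[OF M] slice_mem f)
  finally show "{x \<in> space M. a < f x} \<in> sets M"
    by (simp add: space_eq[OF M])
qed

lemma integrable_L:
  assumes "sets M = supp_sigma" "f \<in> L" "finite_measure M"
  shows "integrable M f"
proof -
  interpret finite_measure M by fact
  show ?thesis
    by (rule integrable_const_bound[of _ 1])
      (use assms measurable nonneg le_one space_eq in \<open>auto intro!: AE_I2\<close>)
qed

text \<open>The slices at height 0 are \<open>min 1 (k f)\<close> on \<open>X\<close>. They converge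
  pointwise to the indicator of \<open>supp f\<close> and are dominated by the constant 1.\<close>

lemma integral_slices_tendsto:
  assumes M: "sets M = supp_sigma" and f: "f \<in> L" and "finite_measure M"
  shows "(\<lambda>k. \<integral>x. slice k 0 f x \<partial>M) \<longlonglongrightarrow> measure M (supp f)"
proof -
  interpret finite_measure M by fact
  note [measurable] = supp_in_sets[OF M f]
  have lim: "(\<lambda>k. slice k 0 f x) \<longlonglongrightarrow> indicator (supp f) x" if "x \<in> X" for x
  proof (cases "f x > 0")
    case True
    then have "eventually (\<lambda>k. slice k 0 f x = 1) sequentially"
      using slice_eq_one[of f x] by (auto simp: eventually_sequentially)
    then show ?thesis using True that by (simp add: supp_def tendsto_eventually)
  next
    case False
    then have "f x = 0" using nonneg[OF f that] by simp
    then show ?thesis by (simp add: slice_def supp_def)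
  qed
  have "(\<lambda>k. \<integral>x. slice k 0 f x \<partial>M) \<longlonglongrightarrow> (\<integral>x. indicator (supp f) x \<partial>M)"
    by (rule integral_dominated_convergence[where w = "\<lambda>_. 1"])
      (use lim measurable[OF M slice_mem[OF f]] le_one[OF slice_mem[OF f]] nonneg[OF slice_mem[OF f]]
        in \<open>auto intro!: AE_I2 simp: space_eq[OF M]\<close>)
  then show ?thesis using supp_subset by (simp add: space_eq[OF M] Int_absorb1 Int_absorb2)
qed

lemma measure_eqI_integral:
  assumes M: "sets M = supp_sigma" "finite_measure M"
    and N: "sets N = supp_sigma" "finite_measure N"
    and eq: "\<And>f. f \<in> L \<Longrightarrow> (\<integral>x. f x \<partial>M) = (\<integral>x. f x \<partial>N)"
  shows "M = N"
proof (rule measure_eqI_generator_eq[OF Int_stable_supp])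
  show "supp ` L \<subseteq> Pow X" using supp_subset by auto
  show "sets M = sigma_sets X (supp ` L)" "sets N = sigma_sets X (supp ` L)"
    using M(1) N(1) by (simp_all add: supp_sigma_def)
  fix U assume "U \<in> supp ` L"
  then obtain f where f: "f \<in> L" "U = supp f" by auto
  have "measure M U = measure N U"
    using integral_slices_tendsto[OF M(1) f(1) M(2)] integral_slices_tendsto[OF N(1) f(1) N(2)]
    unfolding eq[OF slice_mem[OF f(1)]] f(2) by (rule LIMSEQ_unique)
  then show "emeasure M U = emeasure N U"
    using M(2) N(2) by (simp add: finite_measure.emeasure_eq_measure)
next
  have "supp (\<lambda>x. 1) = X" by (simp add: supp_def)
  then show "range (\<lambda>i::nat. X) \<subseteq> supp ` L" using one by force
  show "(\<Union>i::nat. X) = X" by simp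
  show "emeasure M X \<noteq> \<infinity>"
    using M(2) by (simp add: finite_measure.emeasure_finite)
qed

end

section \<open>Additive functionals: comparison of finite and countable sums\<close>

locale mv_functional = mv_functions X L
  for X :: "'a::topological_space set" and L +
  fixes S :: "('a \<Rightarrow> real) \<Rightarrow> real"
  assumes S_cong: "\<lbrakk>f \<in> L; \<And>x. x \<in> X \<Longrightarrow> f x = g x\<rbrakk> \<Longrightarrow> S f = S g"
    and S_nonneg: "f \<in> L \<Longrightarrow> 0 \<le> S f"
    and S_one: "S (\<lambda>x. 1) = 1"
    and S_add: "\<lbrakk>f \<in> L; g \<in> L; \<And>x. x \<in> X \<Longrightarrow> f x + g x \<le> 1\<rbrakk>
      \<Longrightarrow> S (\<lambda>x. f x + g x) = S f + S g"
begin

lemma S_diff: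
  assumes "f \<in> L" "g \<in> L" "\<And>x. x \<in> X \<Longrightarrow> g x \<le> f x"
  shows "S (\<lambda>x. f x - g x) = S f - S g"
  using S_add[OF diff[OF assms] assms(2)] le_one[OF assms(1)] by simp

lemma S_zero: "S (\<lambda>x. 0) = 0"
  using S_add[OF zero one] by simp

text \<open>A form of the Riesz decomposition property.\<close>

lemma subtract_from_sum:
  assumes "f \<in> L" "set gs \<subseteq> L" "\<And>x. x \<in> X \<Longrightarrow> f x \<le> (\<Sum>g\<leftarrow>gs. g x)"
  shows "\<exists>hs. set hs \<subseteq> L \<and> (\<forall>x\<in>X. (\<Sum>h\<leftarrow>hs. h x) = (\<Sum>g\<leftarrow>gs. g x) - f x) \<and>
    (\<Sum>h\<leftarrow>hs. S h) = (\<Sum>g\<leftarrow>gs. S g) - S f"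
  using assms
proof (induction gs arbitrary: f)
  case Nil
  then have "f x = 0" if "x \<in> X" for x
    using nonneg[OF Nil(1) that] that by force
  then have "S f = 0" using S_cong[OF Nil(1), of "\<lambda>x. 0"] S_zero by simp
  then show ?case using \<open>\<And>x. x \<in> X \<Longrightarrow> f x = 0\<close> by (intro exI[of _ "[]"]) auto
next
  case (Cons g gs)
  \<comment> \<open>The head \<open>g\<close> absorbs as much of \<open>f\<close> as it can, namely
    the minimum; the rest of \<open>f\<close> is subtracted from the tail by induction.\<close>
  let ?h = "\<lambda>x. min (f x) (g x)"
  have f: "f \<in> L" and g: "g \<in> L" using Cons.prems by auto
  have h: "?h \<in> L" by (rule min_L[OF f g])
  have fh: "(\<lambda>x. f x - ?h x) \<in> L" and gh: "(\<lambda>x. g x - ?h x) \<in> L"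
    by (rule diff[OF f h], simp, rule diff[OF g h], simp)
  have nn: "0 \<le> (\<Sum>g\<leftarrow>gs. g x)" if "x \<in> X" for x
    using nonneg[OF _ that] Cons.prems(2) by (intro sum_list_nonneg) auto
  have "f x - ?h x \<le> (\<Sum>g\<leftarrow>gs. g x)" if "x \<in> X" for x
    using Cons.prems(3)[OF that] nn[OF that] by (auto simp: min_def)
  then obtain hs where hs: "set hs \<subseteq> L"
    "\<forall>x\<in>X. (\<Sum>h\<leftarrow>hs. h x) = (\<Sum>g\<leftarrow>gs. g x) - (f x - ?h x)"
    "(\<Sum>h\<leftarrow>hs. S h) = (\<Sum>g\<leftarrow>gs. S g) - S (\<lambda>x. f x - ?h x)"
    using Cons.IH[OF fh] Cons.prems(2) by auto
  have "S (\<lambda>x. f x - ?h x) = S f - S ?h" "S (\<lambda>x. g x - ?h x) = S g - S ?h"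
    by (rule S_diff[OF f h], simp, rule S_diff[OF g h], simp)
  then show ?case
    using hs gh by (intro exI[of _ "(\<lambda>x. g x - ?h x) # hs"]) auto
qed

text \<open>Sums of members of \<open>L\<close> may exceed 1 and leave \<open>L\<close>, where
  additivity of \<open>S\<close> says nothing. Lists stand for such sums, with repetition for
  integer multiples. The functions on the left are peeled off one at a time, each being subtracted
  from the list on the right at the exact cost \<open>S f\<close>.\<close>

lemma S_sum_mono:
  assumes "set fs \<subseteq> L" "set gs \<subseteq> L"
    "\<And>x. x \<in> X \<Longrightarrow> (\<Sum>f\<leftarrow>fs. f x) \<le> (\<Sum>g\<leftarrow>gs. g x)"
  shows "(\<Sum>f\<leftarrow>fs. S f) \<le> (\<Sum>g\<leftarrow>gs. S g)"
  using assms
proof (induction fs arbitrary: gs)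
  case Nil
  then show ?case using S_nonneg by (force intro!: sum_list_nonneg)
next
  case (Cons f fs)
  have "f x \<le> (\<Sum>g\<leftarrow>gs. g x)" if "x \<in> X" for x
  proof -
    have "0 \<le> (\<Sum>f\<leftarrow>fs. f x)"
      using nonneg[OF _ that] Cons.prems(1) by (intro sum_list_nonneg) auto
    then show ?thesis using Cons.prems(3)[OF that] by simp
  qed
  then obtain hs where hs: "set hs \<subseteq> L"
    "\<forall>x\<in>X. (\<Sum>h\<leftarrow>hs. h x) = (\<Sum>g\<leftarrow>gs. g x) - f x"
    "(\<Sum>h\<leftarrow>hs. S h) = (\<Sum>g\<leftarrow>gs. S g) - S f"
    using subtract_from_sum[of f gs] Cons.prems by auto
  have "(\<Sum>f\<leftarrow>fs. S f) \<le> (\<Sum>h\<leftarrow>hs. S h)"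
    using Cons.prems hs by (intro Cons.IH) force+
  then show ?case using hs(3) by simp
qed

text \<open>The slices and \<open>k\<close> copies of \<open>f\<close> are two lists with the same
  pointwise sum, so monotonicity applies in both directions.\<close>

lemma S_slices:
  assumes f: "f \<in> L"
  shows "(\<Sum>j<k. S (slice k (int j) f)) = of_nat k * S f"
proof -
  let ?fs = "map (\<lambda>j. slice k (int j) f) [0..<k]" and ?gs = "replicate k f"
  have eq: "(\<Sum>f\<leftarrow>?fs. f x) = (\<Sum>f\<leftarrow>?gs. f x)" if "x \<in> X" for x
    using sum_slices[OF f that, of k]
    by (simp add: comp_def sum_list_replicate interv_sum_list_conv_sum_set_nat atLeast0LessThan)
  have "set ?fs \<subseteq> L" "set ?gs \<subseteq> L" using f slice_mem[OF f] by auto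
  then have "(\<Sum>f\<leftarrow>?fs. S f) = (\<Sum>f\<leftarrow>?gs. S f)"
    using eq by (intro antisym S_sum_mono) auto
  then show ?thesis
    by (simp add: comp_def sum_list_replicate interv_sum_list_conv_sum_set_nat atLeast0LessThan)
qed

text \<open>The constant function \<open>1 / Suc k\<close> need not belong to \<open>L\<close>.
  Multiplying the inequality by \<open>Suc k\<close> turns it into the constant 1, at which
  \<open>S\<close> is known.\<close>

lemma S_approx_mono:
  fixes g :: "nat \<Rightarrow> 'a \<Rightarrow> real"
  assumes f: "f \<in> L" and g: "\<And>i. g i \<in> L"
    and le: "\<And>x. x \<in> X \<Longrightarrow> f x \<le> (\<Sum>i<n. g i x) + 1 / Suc k"
  shows "S f \<le> (\<Sum>i<n. S (g i)) + 1 / Suc k"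
proof -
  let ?gs = "concat (replicate (Suc k) (map g [0..<n]))"
  have conc: "(\<Sum>h\<leftarrow>concat (replicate m (map g [0..<n])). F h) = of_nat m * (\<Sum>i<n. F (g i))"
    for m and F :: "('a \<Rightarrow> real) \<Rightarrow> real"
    by (induction m)
      (simp_all add: comp_def interv_sum_list_conv_sum_set_nat atLeast0LessThan algebra_simps)
  have "(\<Sum>h\<leftarrow>replicate (Suc k) f. S h) \<le> (\<Sum>h\<leftarrow>(\<lambda>x. 1) # ?gs. S h)"
  proof (rule S_sum_mono)
    show "set (replicate (Suc k) f) \<subseteq> L" using f by auto
    show "set ((\<lambda>x. 1) # ?gs) \<subseteq> L" using one g by auto
    fix x assume "x \<in> X"
    have "of_nat (Suc k) * f x \<le> of_nat (Suc k) * ((\<Sum>i<n. g i x) + 1 / Suc k)"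
      by (rule mult_left_mono[OF le[OF \<open>x \<in> X\<close>]]) simp
    also have "\<dots> = 1 + of_nat (Suc k) * (\<Sum>i<n. g i x)"
      by (simp add: field_simps)
    finally show "(\<Sum>h\<leftarrow>replicate (Suc k) f. h x) \<le> (\<Sum>h\<leftarrow>(\<lambda>x. 1) # ?gs. h x)"
      unfolding sum_list_replicate map_replicate list.map sum_list.Cons conc .
  qed
  then have "of_nat (Suc k) * S f \<le> 1 + of_nat (Suc k) * (\<Sum>i<n. S (g i))"
    unfolding sum_list_replicate map_replicate list.map sum_list.Cons conc S_one .
  then show ?thesis by (simp add: field_simps del: of_nat_Suc)
qed

text \<open>Compactness, as in Dini's theorem, reduces a countable sum to a finite one.\<close>

lemma S_le_suminf:
  assumes f: "f \<in> L" and g: "\<And>i. g i \<in> L"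
    and le: "\<And>x. x \<in> X \<Longrightarrow> 0 < f x \<Longrightarrow> 1 \<le> (\<Sum>i. ennreal (g i x))"
  shows "ennreal (S f) \<le> (\<Sum>i. ennreal (S (g i)))"
proof (rule ennreal_le_epsilon)
  fix e :: real assume "0 < e"
  then obtain k where k: "1 / Suc k < e" using reals_Archimedean by (metis inverse_eq_divide)
  \<comment> \<open>Strictness makes these sets relatively open, and the slack
    \<open>1 / Suc k\<close> ensures that every point lies in one of them.\<close>
  define U where "U n = {x \<in> X. 0 < (\<Sum>i<n. g i x) + 1 / Suc k - f x}" for n :: nat
  have U_open: "openin (top_of_set X) (U n)" for n
  proof -
    have "continuous_on X (\<lambda>x. (\<Sum>i<n. g i x) + 1 / Suc k - f x)"
      by (intro continuous_intros cont f g)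
    from continuous_openin_preimage_gen[OF this open_greaterThan[of 0]]
    show ?thesis by (simp add: U_def vimage_def Int_def)
  qed
  have cover: "\<exists>n. x \<in> U n" if x: "x \<in> X" for x
  proof (cases "f x - 1 / Suc k < 0")
    case True
    then show ?thesis using x by (auto simp: U_def intro!: exI[of _ 0])
  next
    case False
    moreover have "0 < 1 / real (Suc k)" by simp
    ultimately have fx: "0 < f x" "0 \<le> f x - 1 / Suc k" by linarith+
    \<comment> \<open>A value strictly below 1 is exceeded by a finite partial sum, even if the
      series reaches 1 only in the limit.\<close>
    have "ennreal (f x - 1 / Suc k) < ennreal 1"
      using fx le_one[OF f x] \<open>0 < 1 / real (Suc k)\<close> by (intro ennreal_lessI) linarith+
    also have "\<dots> \<le> (\<Sum>i. ennreal (g i x))" using le[OF x fx(1)] by simp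
    also have "\<dots> = (SUP n. ennreal (\<Sum>i<n. g i x))"
      by (simp add: suminf_eq_SUP nonneg[OF g x])
    finally obtain n where "ennreal (f x - 1 / Suc k) < ennreal (\<Sum>i<n. g i x)"
      unfolding less_SUP_iff by auto
    then have "f x - 1 / Suc k < (\<Sum>i<n. g i x)"
      using fx(2) by (simp add: ennreal_less_iff)
    then show ?thesis using x by (auto simp: U_def intro!: exI[of _ n])
  qed
  have U_mono: "U m \<subseteq> U n" if "m \<le> n" for m n
  proof
    fix x assume x: "x \<in> U m"
    then have "(\<Sum>i<m. g i x) \<le> (\<Sum>i<n. g i x)"
      using that nonneg[OF g] by (intro sum_mono2) (auto simp: U_def)
    then show "x \<in> U n" using x by (auto simp: U_def)
  qed
  obtain D where D: "finite D" "X \<subseteq> \<Union>(U ` D)"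
  proof -
    have "\<forall>n. \<exists>T. open T \<and> U n = X \<inter> T" using U_open by (auto simp: openin_open)
    then obtain T where T: "\<And>n. open (T n)" "\<And>n. U n = X \<inter> T n" by metis
    have "X \<subseteq> \<Union>(range T)" using cover T(2) by blast
    then obtain D where "finite D" "X \<subseteq> \<Union>(T ` D)"
      using compactE_image[OF compact_X, of UNIV T] T(1) by metis
    then show thesis using that[of D] T(2) by blast
  qed
  have "X \<subseteq> U (Max (insert 0 D))"
  proof
    fix x assume "x \<in> X"
    then obtain m where "m \<in> D" "x \<in> U m" using D(2) by auto
    then show "x \<in> U (Max (insert 0 D))" using U_mono[of m "Max (insert 0 D)"] D(1) by auto
  qed
  then obtain n where n: "X \<subseteq> U n" by blast
  have "S f \<le> (\<Sum>i<n. S (g i)) + 1 / Suc k"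
    by (rule S_approx_mono[OF f g]) (use n in \<open>force simp: U_def\<close>)
  also have "\<dots> \<le> (\<Sum>i<n. S (g i)) + e" using k by simp
  finally have "ennreal (S f) \<le> ennreal ((\<Sum>i<n. S (g i)) + e)" by (rule ennreal_leI)
  also have "\<dots> = (\<Sum>i<n. ennreal (S (g i))) + ennreal e"
    using \<open>0 < e\<close> by (simp add: S_nonneg[OF g] sum_nonneg)
  also have "\<dots> \<le> (\<Sum>i. ennreal (S (g i))) + ennreal e"
    by (intro add_right_mono sum_le_suminf) auto
  finally show "ennreal (S f) \<le> (\<Sum>i. ennreal (S (g i))) + ennreal e" .
qed

section \<open>The outer measure induced by \<open>S\<close>\<close>

definition cover :: "(nat \<Rightarrow> 'a \<Rightarrow> real) \<Rightarrow> 'a set \<Rightarrow> bool" where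
  "cover g A \<longleftrightarrow> (\<forall>i. g i \<in> L) \<and> (\<forall>x\<in>A. 1 \<le> (\<Sum>i. ennreal (g i x)))"

text \<open>Daniell's upper integral of the indicator of \<open>A\<close>. Finite covers are
  included by padding with the zero function, which costs nothing.\<close>

definition outer :: "'a set \<Rightarrow> ennreal" where
  "outer A = (INF g\<in>{g. cover g A}. \<Sum>i. ennreal (S (g i)))"

lemma outer_le: "cover g A \<Longrightarrow> outer A \<le> (\<Sum>i. ennreal (S (g i)))"
  unfolding outer_def by (rule INF_lower) simp

lemma outer_mono: "A \<subseteq> B \<Longrightarrow> outer A \<le> outer B"
  unfolding outer_def by (rule INF_superset_mono) (auto simp: cover_def)

lemma outer_empty: "outer {} = 0"
  using outer_le[of "\<lambda>_ _. 0" "{}"] zero by (simp add: cover_def S_zero)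

lemma outer_countably_subadditive:
  "outer (\<Union>i::nat. A i) \<le> (\<Sum>i. outer (A i))"
proof (rule ennreal_le_epsilon)
  fix e :: real assume "0 < e" and fin: "(\<Sum>i. outer (A i)) < top"
  \<comment> \<open>Since the sum is finite, so is each \<open>outer (A n)\<close>; adding the share
    \<open>e * (1/2)^Suc n\<close> is therefore a strict increase, and some cover costs less. The
    shares sum to \<open>e\<close>.\<close>
  have "\<exists>g. cover g (A n) \<and> (\<Sum>i. ennreal (S (g i))) \<le> outer (A n) + e * (1/2)^Suc n" for n
  proof -
    have "outer (A n) < outer (A n) + e * (1/2)^Suc n"
      using \<open>0 < e\<close> ennreal_suminf_lessD[OF fin, of n] by (auto simp: less_top)
    then show ?thesis unfolding outer_def[of "A n"] INF_less_iff
      by (auto simp: outer_def[symmetric] intro: less_imp_le)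
  qed
  then obtain g where g: "\<And>n. cover (g n) (A n)"
    and le: "\<And>n. (\<Sum>i. ennreal (S (g n i))) \<le> outer (A n) + e * (1/2)^Suc n" by metis
  let ?h = "\<lambda>m. case_prod g (prod_decode m)"
  have "cover ?h (\<Union>i. A i)"
    unfolding cover_def
  proof (intro conjI allI ballI)
    show "?h i \<in> L" for i using g by (auto simp: cover_def split: prod.split)
    fix x assume "x \<in> (\<Union>i. A i)"
    then obtain n where "x \<in> A n" by auto
    then have "1 \<le> (\<Sum>i. ennreal (g n i x))" using g by (auto simp: cover_def)
    also have "\<dots> \<le> (\<Sum>n. \<Sum>i. ennreal (g n i x))"
      using sum_le_suminf[of "\<lambda>n. \<Sum>i. ennreal (g n i x)" "{n}"] by simp
    also have "\<dots> = (\<Sum>m. ennreal (?h m x))"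
      by (subst suminf_ennreal_2dimen[symmetric, of _ "\<lambda>(n, i). ennreal (g n i x)"])
        (auto intro!: suminf_cong split: prod.split)
    finally show "1 \<le> (\<Sum>m. ennreal (?h m x))" .
  qed
  then have "outer (\<Union>i. A i) \<le> (\<Sum>m. ennreal (S (?h m)))" by (rule outer_le)
  also have "\<dots> = (\<Sum>n. \<Sum>i. ennreal (S (g n i)))"
    by (subst suminf_ennreal_2dimen[symmetric, of _ "\<lambda>(n, i). ennreal (S (g n i))"])
      (auto intro!: suminf_cong split: prod.split)
  also have "\<dots> \<le> (\<Sum>n. outer (A n) + e * (1/2)^Suc n)"
    by (intro suminf_le allI le) auto
  also have "\<dots> = (\<Sum>n. outer (A n)) + (\<Sum>n. ennreal e * ennreal ((1/2) ^ Suc n))"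
    using \<open>0 < e\<close> by (subst suminf_add[symmetric])
      (auto simp del: ennreal_suminf_cmult simp add: ennreal_mult[symmetric])
  also have "\<dots> = (\<Sum>n. outer (A n)) + e"
    unfolding ennreal_suminf_cmult
    by (subst suminf_ennreal_eq[OF zero_le_power power_half_series]) auto
  finally show "outer (\<Union>i. A i) \<le> (\<Sum>n. outer (A n)) + e" .
qed

section \<open>Caratheodory measurability of the positivity sets\<close>

lemma outer_measure_space_outer: "outer_measure_space (Pow X) outer"
  using outer_empty outer_mono outer_countably_subadditive
  by (auto simp: outer_measure_space_def positive_def increasing_def countably_subadditive_def)

text \<open>Covers are series, so an increasing sequence is replaced by its first term and
  successive differences, which lie in \<open>L\<close> by monotonicity. Thus functions increasing
  to 1 on \<open>A\<close> bound its outer measure.\<close>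

lemma outer_le_SUP:
  assumes v: "\<And>n. v n \<in> L" and mono: "\<And>n x. x \<in> X \<Longrightarrow> v n x \<le> v (Suc n) x"
    and A: "A \<subseteq> X" and lim: "\<And>x y. x \<in> A \<Longrightarrow> y < 1 \<Longrightarrow> \<exists>n. y < ennreal (v n x)"
  shows "outer A \<le> (SUP n. ennreal (S (v n)))"
proof -
  define w where "w n = (case n of 0 \<Rightarrow> v 0 | Suc m \<Rightarrow> (\<lambda>x. v (Suc m) x - v m x))" for n
  have w: "w n \<in> L" for n
    using v diff[OF v v mono] by (auto simp: w_def split: nat.split)
  have w_sum: "(\<Sum>i<Suc n. w i x) = v n x" for n x
    by (induction n) (simp_all add: w_def)
  have S_sum: "(\<Sum>i<Suc n. S (w i)) = S (v n)" for n
    using S_diff[OF v v mono] by (induction n) (simp_all add: w_def)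
  have "1 \<le> (\<Sum>i. ennreal (w i x))" if x: "x \<in> A" for x
  proof (rule dense_le)
    fix y :: ennreal assume "y < 1"
    then obtain n where "y < ennreal (v n x)" using lim[OF x] by auto
    also have "\<dots> = (\<Sum>i<Suc n. ennreal (w i x))"
      using nonneg[OF w] A x by (subst sum_ennreal) (auto simp only: w_sum)
    also have "\<dots> \<le> (\<Sum>i. ennreal (w i x))"
      by (rule sum_le_suminf) auto
    finally show "y \<le> (\<Sum>i. ennreal (w i x))" by simp
  qed
  then have "outer A \<le> (\<Sum>i. ennreal (S (w i)))"
    using w by (intro outer_le) (simp add: cover_def)
  also have "\<dots> = (SUP n. ennreal (\<Sum>i<n. S (w i)))"
    by (simp add: suminf_eq_SUP S_nonneg[OF w])
  also have "\<dots> \<le> (SUP n. ennreal (S (v n)))"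
  proof (rule SUP_least)
    fix n
    show "ennreal (\<Sum>i<n. S (w i)) \<le> (SUP n. ennreal (S (v n)))"
      by (cases n) (auto simp del: sum.lessThan_Suc simp: S_sum intro: SUP_upper)
  qed
  finally show ?thesis .
qed

text \<open>The cost of a given cover is shared between the two pieces. The truncated partial sum
  \<open>h k\<close> splits into \<open>v k\<close>, which vanishes off \<open>supp f\<close>, and
  \<open>h k - v k\<close>. The \<open>v k\<close> increase to 1 on
  \<open>A \<inter> supp f\<close>, while \<open>h k - v k\<close> and the remaining terms of the
  cover still cover \<open>A - supp f\<close>. For each \<open>k\<close> the two costs together do
  not exceed that of \<open>g\<close>.\<close>

lemma outer_split_le:
  assumes f: "f \<in> L" and A: "A \<subseteq> X" and g: "cover g A"
  shows "outer (A \<inter> supp f) + outer (A - supp f) \<le> (\<Sum>i. ennreal (S (g i)))"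
proof -
  have gL: "g i \<in> L" for i using g by (simp add: cover_def)
  define h where "h k x = min 1 (\<Sum>i<k. g i x)" for k x
  define v where "v k x = min (h k x) (slice k 0 f x)" for k x
  have h: "h k \<in> L" for k unfolding h_def by (rule truncated_sum[OF gL])
  have v: "v k \<in> L" for k unfolding v_def by (rule min_L[OF h slice_mem[OF f]])
  have v_le: "v k x \<le> h k x" for k x by (simp add: v_def)
  have G_mono: "(\<Sum>i<m. g i x) \<le> (\<Sum>i<n. g i x)" if "x \<in> X" "m \<le> n" for m n x
    using that nonneg[OF gL] by (intro sum_mono2) auto
  have G1: "1 \<le> (SUP n. ennreal (\<Sum>i<n. g i x))" if "x \<in> A" for x
  proof -
    have "1 \<le> (\<Sum>i. ennreal (g i x))" using g that by (simp add: cover_def)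
    also have "\<dots> = (SUP n. ennreal (\<Sum>i<n. g i x))"
      using that A by (simp add: suminf_eq_SUP nonneg[OF gL] subset_iff)
    finally show ?thesis .
  qed
  have inter: "outer (A \<inter> supp f) \<le> (SUP k. ennreal (S (v k)))"
  proof (rule outer_le_SUP[OF v])
    fix n x assume "x \<in> X"
    then show "v n x \<le> v (Suc n) x"
      using G_mono[of x n "Suc n"] nonneg[OF f \<open>x \<in> X\<close>]
      unfolding v_def h_def slice_def by (intro min.mono max.mono) (auto simp: algebra_simps)
  next
    show "A \<inter> supp f \<subseteq> X" using A by auto
    fix x y assume x: "x \<in> A \<inter> supp f" and y: "y < (1::ennreal)"
    then obtain K where K: "\<And>k. k \<ge> K \<Longrightarrow> slice k 0 f x = 1"
      using slice_eq_one[of f x] by (auto simp: supp_def)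
    have "y < (SUP n. ennreal (\<Sum>i<n. g i x))" using y G1 x by (auto intro: less_le_trans)
    then obtain n where n: "y < ennreal (\<Sum>i<n. g i x)" by (auto simp: less_SUP_iff)
    let ?m = "max n K"
    have "y < ennreal (\<Sum>i<?m. g i x)"
      using n G_mono[of x n ?m] x A by (auto intro!: less_le_trans[OF n] ennreal_leI)
    then have "y < ennreal (v ?m x)" using y by (auto simp: v_def h_def K min_def)
    then show "\<exists>n. y < ennreal (v n x)" ..
  qed
  have compl: "outer (A - supp f) + ennreal (S (v k)) \<le> (\<Sum>i. ennreal (S (g i)))" for k
  proof -
    \<comment> \<open>The first \<open>k\<close> terms of the cover are merged into the single
      function \<open>h k - v k\<close>; the others are kept.\<close>
    define w where "w n = (case n of 0 \<Rightarrow> (\<lambda>x. h k x - v k x) | Suc m \<Rightarrow> g (m + k))" for n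
    have w: "w n \<in> L" for n
      using gL diff[OF h v v_le] by (auto simp: w_def split: nat.split)
    have w_sum: "(\<Sum>i. F (w i)) = (\<Sum>i. F (g (i + k))) + F (\<lambda>x. h k x - v k x)"
      for F :: "('a \<Rightarrow> real) \<Rightarrow> ennreal"
      using suminf_offset[of "\<lambda>i. F (w i)" 1] by (simp add: w_def)
    have "cover w (A - supp f)"
      unfolding cover_def
    proof (intro conjI allI ballI w)
      fix x assume x: "x \<in> A - supp f"
      then have "f x = 0" using nonneg[OF f, of x] A by (auto simp: supp_def)
      then have "v k x = 0" using nonneg[OF h[of k], of x] x A by (auto simp: v_def slice_def)
      then have eq: "(\<Sum>i. ennreal (w i x)) = (\<Sum>i. ennreal (g (i + k) x)) + ennreal (h k x)"
        using w_sum[of "\<lambda>f. ennreal (f x)"] by simp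
      show "1 \<le> (\<Sum>i. ennreal (w i x))"
      \<comment> \<open>If the partial sum reaches 1, then \<open>h k x = 1\<close> suffices by
        itself. Otherwise no truncation took place and the total is that of the original
        cover.\<close>
      proof (cases "1 \<le> (\<Sum>i<k. g i x)")
        case True
        then show ?thesis unfolding eq by (simp add: h_def)
      next
        case False
        have "1 \<le> (\<Sum>i. ennreal (g i x))" using g x by (simp add: cover_def)
        also have "\<dots> = (\<Sum>i. ennreal (g (i + k) x)) + (\<Sum>i<k. ennreal (g i x))"
          by (rule suminf_offset) simp
        also have "(\<Sum>i<k. ennreal (g i x)) = ennreal (h k x)"
          using False x A by (subst sum_ennreal) (auto simp: h_def nonneg[OF gL])
        finally show ?thesis unfolding eq .
      qed
    qed
    then have "outer (A - supp f) + ennreal (S (v k)) \<le>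
        (\<Sum>i. ennreal (S (w i))) + ennreal (S (v k))"
      by (intro add_right_mono outer_le)
    also have "\<dots> = (\<Sum>i. ennreal (S (g (i + k)))) +
        (ennreal (S (\<lambda>x. h k x - v k x)) + ennreal (S (v k)))"
      unfolding w_sum[of "\<lambda>f. ennreal (S f)"] by (simp add: add.assoc)
    also have "ennreal (S (\<lambda>x. h k x - v k x)) + ennreal (S (v k)) = ennreal (S (h k))"
      using S_nonneg[OF v] S_nonneg[OF diff[OF h v v_le]] S_diff[OF h v v_le]
      by (simp flip: ennreal_plus)
    also have "S (h k) \<le> (\<Sum>i<k. S (g i))"
      using S_sum_mono[of "[h k]" "map g [0..<k]"] h gL
      by (auto simp: h_def comp_def interv_sum_list_conv_sum_set_nat atLeast0LessThan)
    then have "ennreal (S (h k)) \<le> (\<Sum>i<k. ennreal (S (g i)))"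
      by (simp add: S_nonneg[OF gL] ennreal_leI)
    then have "(\<Sum>i. ennreal (S (g (i + k)))) + ennreal (S (h k)) \<le>
        (\<Sum>i. ennreal (S (g (i + k)))) + (\<Sum>i<k. ennreal (S (g i)))"
      by (rule add_left_mono)
    also have "\<dots> = (\<Sum>i. ennreal (S (g i)))" by (rule suminf_offset[symmetric]) simp
    finally show ?thesis .
  qed
  \<comment> \<open>The bound \<open>compl\<close> is uniform in \<open>k\<close>, so
    \<open>S (v k)\<close> may be replaced by its supremum, which dominates the outer measure of
    \<open>A \<inter> supp f\<close>.\<close>
  have "outer (A - supp f) + outer (A \<inter> supp f) \<le>
      outer (A - supp f) + (SUP k. ennreal (S (v k)))"
    by (rule add_left_mono[OF inter])
  also have "\<dots> \<le> (\<Sum>i. ennreal (S (g i)))"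
    by (subst ennreal_SUP_add_right) (auto intro!: SUP_least compl)
  finally show ?thesis by (simp add: add.commute)
qed

lemma supp_in_lambda_system:
  assumes f: "f \<in> L"
  shows "supp f \<in> lambda_system X (Pow X) outer"
proof -
  interpret sigma_algebra X "Pow X" by (rule sigma_algebra_Pow)
  have "outer (A \<inter> supp f) + outer (A - supp f) = outer A" if A: "A \<subseteq> X" for A
  proof (rule antisym)
    show "outer (A \<inter> supp f) + outer (A - supp f) \<le> outer A"
      unfolding outer_def[of A] by (rule INF_greatest) (use outer_split_le[OF f A] in auto)
    have "subadditive (Pow X) outer"
      using outer_measure_space_outer
      by (intro countably_subadditive_subadditive) (auto simp: outer_measure_space_def)
    from subadditiveD[OF this, of "A \<inter> supp f" "A - supp f"] A
    show "outer A \<le> outer (A \<inter> supp f) + outer (A - supp f)"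
      by (auto simp: Int_Diff_Un)
  qed
  then show ?thesis using supp_subset by (auto simp: lambda_system_eq)
qed

section \<open>The representing measure\<close>

definition rep_measure :: "'a measure" where
  "rep_measure = measure_of X supp_sigma outer"

lemma sigma_algebra_supp_sigma: "sigma_algebra X supp_sigma"
  unfolding supp_sigma_def by (rule sigma_algebra_sigma_sets) (use supp_subset in auto)

lemma sets_rep_measure: "sets rep_measure = supp_sigma"
  unfolding rep_measure_def by (rule sigma_algebra.sets_measure_of_eq[OF sigma_algebra_supp_sigma])

text \<open>The values prescribed to \<open>measure_of\<close> are attained once
  \<open>outer\<close> is countably additive on \<open>supp_sigma\<close>. It is, because the
  generators, and with them all of \<open>supp_sigma\<close>, are Caratheodory measurable.\<close>

lemma emeasure_rep_measure:
  assumes "A \<in> supp_sigma"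
  shows "emeasure rep_measure A = outer A"
proof -
  have lam: "measure_space X (lambda_system X (Pow X) outer) outer"
    by (rule sigma_algebra.caratheodory_lemma[OF sigma_algebra_Pow outer_measure_space_outer])
  have "supp_sigma \<subseteq> lambda_system X (Pow X) outer"
    unfolding supp_sigma_def using lam supp_in_lambda_system
    by (intro sigma_algebra.sigma_sets_subset) (auto simp: measure_space_def)
  then have "measure_space X supp_sigma outer"
    by (rule measure_down[OF lam sigma_algebra_supp_sigma])
  then show ?thesis
    unfolding rep_measure_def using assms
    by (intro emeasure_measure_of_sigma) (auto simp: measure_space_def)
qed

lemma S_le_outer_supp: "f \<in> L \<Longrightarrow> ennreal (S f) \<le> outer (supp f)"
  unfolding outer_def
  by (rule INF_greatest, rule S_le_suminf) (auto simp: cover_def supp_def)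

lemma outer_le_S:
  assumes f: "f \<in> L" and A: "\<And>x. x \<in> A \<Longrightarrow> 1 \<le> f x"
  shows "outer A \<le> ennreal (S f)"
proof -
  let ?g = "\<lambda>i. if i = 0 then f else (\<lambda>x. 0)"
  have sum: "(\<Sum>i. F (?g i)) = F f" if "F (\<lambda>x. 0) = 0" for F :: "('a \<Rightarrow> real) \<Rightarrow> ennreal"
    using that by (subst suminf_finite[of "{0}"]) auto
  have "cover ?g A" using f zero A sum[of "\<lambda>f. ennreal (f x)" for x] by (auto simp: cover_def)
  from outer_le[OF this] show ?thesis using sum[of "\<lambda>f. ennreal (S f)"] S_zero by simp
qed

lemma prob_space_rep_measure: "prob_space rep_measure"
proof
  have X: "X = supp (\<lambda>x. 1)" by (simp add: supp_def)
  have "X \<in> supp_sigma" using one by (subst X) (auto simp: supp_sigma_def)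
  moreover have "outer X = 1"
    using S_le_outer_supp[OF one] outer_le_S[OF one, of X] by (simp add: X[symmetric] S_one)
  ultimately show "emeasure rep_measure (space rep_measure) = 1"
    by (simp add: space_eq[OF sets_rep_measure] emeasure_rep_measure)
qed

lemma integral_rep_measure:
  assumes f: "f \<in> L"
  shows "(\<integral>x. f x \<partial>rep_measure) = S f"
proof -
  interpret M: prob_space rep_measure by (rule prob_space_rep_measure)
  let ?M = rep_measure
  note space = space_eq[OF sets_rep_measure]
  have em: "ennreal (M.prob A) = outer A" if "A \<in> sets ?M" for A
    using emeasure_rep_measure[of A] that M.emeasure_eq_measure[of A]
    by (simp only: sets_rep_measure)
  \<comment> \<open>Both \<open>S g\<close> and the integral of \<open>g\<close> lie between the
    measures of the sets where \<open>g\<close> equals 1 and where it is positive.\<close>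
  have bounds: "S g \<le> M.prob (supp g)" "M.prob {x \<in> X. g x = 1} \<le> S g"
    "(\<integral>x. g x \<partial>?M) \<le> M.prob (supp g)" "M.prob {x \<in> X. g x = 1} \<le> (\<integral>x. g x \<partial>?M)"
    if g: "g \<in> L" for g
  proof -
    have s: "supp g \<in> sets ?M" by (rule supp_in_sets[OF sets_rep_measure g])
    have "{x \<in> X. g x = 1} = X - supp (\<lambda>x. 1 - g x)"
      using le_one[OF g] by (force simp: supp_def)
    also have "\<dots> \<in> sets ?M"
      using supp_in_sets[OF sets_rep_measure compl[OF g]] sets.compl_sets[of _ ?M] space by metis
    finally have t: "{x \<in> X. g x = 1} \<in> sets ?M" .
    note ig = integrable_L[OF sets_rep_measure g M.finite_measure_axioms]
    show "S g \<le> M.prob (supp g)"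
      using S_le_outer_supp[OF g] unfolding em[OF s, symmetric]
      by (simp only: ennreal_le_iff[OF measure_nonneg])
    show "M.prob {x \<in> X. g x = 1} \<le> S g"
      using outer_le_S[OF g, of "{x \<in> X. g x = 1}"] unfolding em[OF t, symmetric]
      by (simp only: ennreal_le_iff[OF S_nonneg[OF g]] mem_Collect_eq order.refl)
    have "(\<integral>x. g x \<partial>?M) \<le> (\<integral>x. indicator (supp g) x \<partial>?M)"
    proof (rule integral_mono[OF ig])
      show "integrable ?M (indicat_real (supp g))"
        using s by (simp add: M.emeasure_eq_measure)
      fix x assume "x \<in> space ?M"
      then show "g x \<le> indicat_real (supp g) x"
        using le_one[OF g, of x] by (auto simp: space supp_def indicator_def)
    qed
    then show "(\<integral>x. g x \<partial>?M) \<le> M.prob (supp g)"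
      using supp_subset by (simp add: space Int_absorb2)
    have "(\<integral>x. indicator {x \<in> X. g x = 1} x \<partial>?M) \<le> (\<integral>x. g x \<partial>?M)"
    proof (rule integral_mono[OF _ ig])
      show "integrable ?M (indicat_real {x \<in> X. g x = 1})"
        using t by (simp add: M.emeasure_eq_measure)
      fix x assume "x \<in> space ?M"
      then show "indicat_real {x \<in> X. g x = 1} x \<le> g x"
        using nonneg[OF g, of x] by (auto simp: space indicator_def)
    qed
    then show "M.prob {x \<in> X. g x = 1} \<le> (\<integral>x. g x \<partial>?M)"
      by (simp add: space Int_absorb2 subset_eq)
  qed
  \<comment> \<open>Slice \<open>j + 1\<close> is positive only where slice \<open>j\<close> equals
    1. Hence the error on slice \<open>j\<close> is at most the drop in measure between the
    positivity sets of these two slices, and the drops telescope to at most 1 for every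
    \<open>k\<close>.\<close>
  have close: "real k * \<bar>S f - (\<integral>x. f x \<partial>?M)\<bar> \<le> 1" for k
  proof -
    let ?t = "\<lambda>j::nat. slice k (int j) f"
    have t: "?t j \<in> L" for j by (rule slice_mem[OF f])
    have succ: "M.prob (supp (?t (Suc j))) \<le> M.prob {x \<in> X. ?t j x = 1}" for j
    proof (rule M.finite_measure_mono)
      show "supp (?t (Suc j)) \<subseteq> {x \<in> X. ?t j x = 1}"
        by (auto simp: supp_def slice_def max_def min_def split: if_splits)
      have "{x \<in> X. ?t j x = 1} = {x \<in> space ?M. ?t j x = 1}" by (simp add: space)
      also have "\<dots> \<in> sets ?M"
        using measurable[OF sets_rep_measure t] by measurable
      finally show "{x \<in> X. ?t j x = 1} \<in> sets ?M" .
    qed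
    have d: "\<bar>S (?t j) - (\<integral>x. ?t j x \<partial>?M)\<bar>
        \<le> M.prob (supp (?t j)) - M.prob (supp (?t (Suc j)))" for j
      using bounds[OF t[of j]] succ[of j] unfolding abs_le_iff by linarith
    have "real k * (\<integral>x. f x \<partial>?M) = (\<integral>x. real k * f x \<partial>?M)" by simp
    also have "\<dots> = (\<integral>x. (\<Sum>j<k. ?t j x) \<partial>?M)"
      by (rule Bochner_Integration.integral_cong) (simp_all add: space sum_slices[OF f])
    also have "\<dots> = (\<Sum>j<k. \<integral>x. ?t j x \<partial>?M)"
      by (rule Bochner_Integration.integral_sum)
        (rule integrable_L[OF sets_rep_measure t M.finite_measure_axioms])
    finally have "real k * (S f - (\<integral>x. f x \<partial>?M)) = (\<Sum>j<k. S (?t j) - (\<integral>x. ?t j x \<partial>?M))"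
      using S_slices[OF f, of k] by (simp add: sum_subtractf right_diff_distrib)
    then have "real k * \<bar>S f - (\<integral>x. f x \<partial>?M)\<bar> = \<bar>\<Sum>j<k. S (?t j) - (\<integral>x. ?t j x \<partial>?M)\<bar>"
      by (metis abs_mult abs_of_nat)
    also have "\<dots> \<le> (\<Sum>j<k. M.prob (supp (?t j)) - M.prob (supp (?t (Suc j))))"
      by (rule order_trans[OF sum_abs sum_mono]) (rule d)
    also have "\<dots> = M.prob (supp (?t 0)) - M.prob (supp (?t k))"
      using sum_lessThan_telescope'[of "\<lambda>j. M.prob (supp (?t j))" k] by simp
    also have "\<dots> \<le> 1"
      using M.prob_le_1[of "supp (?t 0)"] measure_nonneg[of ?M "supp (?t k)"] by linarith
    finally show ?thesis .
  qed
  have "\<not> 0 < \<bar>S f - (\<integral>x. f x \<partial>?M)\<bar>"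
    using close reals_Archimedean3 by (metis not_less)
  then show ?thesis by simp
qed

end

section \<open>McNaughton functions\<close>

text \<open>Unlike \<^const>\<open>mcnaughton\<close>, values off the cube are unconstrained.\<close>

definition mcn :: "(real ^ 'n \<Rightarrow> real) set" where
  "mcn = {f. restrict f unit_cube \<in> mcnaughton}"

lemma mcn_iff:
  "f \<in> mcn \<longleftrightarrow> continuous_on unit_cube f \<and> (\<forall>x\<in>unit_cube. 0 \<le> f x \<and> f x \<le> 1) \<and>
    (\<exists>P. finite P \<and> P \<subseteq> int_affine \<and> (\<forall>x\<in>unit_cube. \<exists>p\<in>P. f x = p x))"
  by (auto simp: mcn_def mcnaughton_def cong: continuous_on_cong_simp)

lemma mcnaughton_imp_mcn:
  assumes "f \<in> mcnaughton"
  shows "f \<in> mcn" "restrict f unit_cube = f"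
proof -
  show "restrict f unit_cube = f"
    using assms by (auto simp: mcnaughton_def PiE_iff extensional_restrict)
  then show "f \<in> mcn" using assms by (simp add: mcn_def)
qed

text \<open>The source of the concrete McNaughton functions used below: the constant 1, the
  coordinates, and the sides of small boxes around a point.\<close>

lemma clip_affine_mcn:
  assumes p: "p \<in> int_affine"
  shows "(\<lambda>x. min 1 (max 0 (p x))) \<in> mcn"
proof -
  have "continuous_on unit_cube p"
    using p by (auto simp: int_affine_def intro!: continuous_intros)
  moreover have "finite {\<lambda>x. 0, \<lambda>x. 1, p} \<and> {\<lambda>x. 0, \<lambda>x. 1, p} \<subseteq> int_affine \<and>
      (\<forall>x\<in>unit_cube. \<exists>q\<in>{\<lambda>x. 0, \<lambda>x. 1, p}. min 1 (max 0 (p x)) = q x)"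
    using p int_affine_const[of 0] int_affine_const[of 1] by (auto simp: min_def max_def)
  ultimately show ?thesis
    unfolding mcn_iff by (intro conjI exI[of _ "{\<lambda>x. 0, \<lambda>x. 1, p}"])
      (auto intro!: continuous_intros)
qed

lemma int_affine_coord:
  "(\<lambda>x. of_int a * x $ i + of_int b) \<in> int_affine"
  unfolding int_affine_def
  by (auto intro!: exI[of _ "\<lambda>j. if j = i then a else 0"] exI[of _ b]
      simp: fun_eq_iff if_distrib[of "\<lambda>x. x * _"] if_distrib[of real_of_int] cong: if_cong)

interpretation mcn: mv_functions "unit_cube :: (real ^ 'n) set" mcn
proof
  fix f g :: "real ^ 'n \<Rightarrow> real"
  show "f \<in> mcn \<Longrightarrow> (\<And>x. x \<in> unit_cube \<Longrightarrow> f x = g x) \<Longrightarrow> g \<in> mcn"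
    by (metis mcn_def mem_Collect_eq restrict_ext)
  show "(\<lambda>x::real ^ 'n. 1) \<in> mcn"
    using clip_affine_mcn[OF int_affine_const[of 1]] by simp
  assume f: "f \<in> mcn"
  show "(\<lambda>x. 1 - f x) \<in> mcn"
    using mcnaughton_neg[of "restrict f unit_cube"] f by (simp add: mcn_def cong: restrict_cong)
  assume g: "g \<in> mcn"
  show "(\<lambda>x. min 1 (f x + g x)) \<in> mcn"
    using mcnaughton_oplus[of "restrict f unit_cube" "restrict g unit_cube"] f g
    by (simp add: mcn_def cong: restrict_cong)
qed (auto simp: mcn_iff compact_cbox)

section \<open>Borel sets and bump functions of the cube\<close>

lemma mcn_supp_sigma:
  "mcn.supp_sigma = sets (restrict_space borel (unit_cube :: (real ^ 'n) set))"
proof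
  let ?X = "unit_cube :: (real ^ 'n) set"
  show "mcn.supp_sigma \<subseteq> sets (restrict_space borel ?X)"
    unfolding mcn.supp_sigma_def
  proof (rule sigma_algebra.sigma_sets_subset)
    show "sigma_algebra ?X (sets (restrict_space borel ?X))"
      using sets.sigma_algebra_axioms[of "restrict_space borel ?X"]
      by (simp add: space_restrict_space)
    show "mcn.supp ` mcn \<subseteq> sets (restrict_space borel ?X)"
      using mcn.openin_supp
      by (fastforce simp: sets_restrict_space openin_open)
  qed
  define M where "M = sigma ?X mcn.supp_sigma"
  have M: "sets M = mcn.supp_sigma"
    unfolding M_def mcn.supp_sigma_def
    by (intro sigma_algebra.sets_measure_of_eq sigma_algebra_sigma_sets)
      (auto simp: mcn.supp_def)
  \<comment> \<open>The coordinates are McNaughton functions on the cube, hence measurable, and so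
    is the inclusion into the ambient space. Preimages of Borel sets under it are their traces on
    the cube.\<close>
  have "(\<lambda>x. x) \<in> borel_measurable M"
  proof (subst borel_measurable_euclidean_space, intro ballI)
    fix b :: "real ^ 'n" assume "b \<in> Basis"
    then obtain i where b: "b = axis i 1" by (auto simp: Basis_vec_def)
    have "(\<lambda>x. x $ i) \<in> mcn"
      by (rule mcn.L_cong[OF clip_affine_mcn[OF int_affine_coord[of 1 i 0]]])
        (auto simp: mem_box_cart)
    then show "(\<lambda>x. x \<bullet> b) \<in> borel_measurable M"
      using mcn.measurable[OF M] by (simp add: b inner_axis)
  qed
  then show "sets (restrict_space borel ?X) \<subseteq> mcn.supp_sigma"
    unfolding M[symmetric] sets_restrict_space
    using measurable_sets[of "\<lambda>x. x" M borel] mcn.space_eq[OF M]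
    by (auto simp: vimage_def Int_def conj_commute)
qed

text \<open>Integer coefficients rule out a bump centred at an arbitrary \<open>a\<close>. Instead,
  \<open>a\<close> is caught in a box with corners in multiples of \<open>1 / k\<close>: two clipped
  affine functions per coordinate bound it on either side, and their common positivity set is the
  box within the cube.\<close>

lemma mcn_bump:
  fixes U :: "(real ^ 'n) set"
  assumes U: "openin (top_of_set unit_cube) U" and a: "a \<in> U"
  shows "\<exists>f\<in>mcn. a \<in> mcn.supp f \<and> mcn.supp f \<subseteq> U"
proof -
  obtain e where e: "0 < e" "ball a e \<inter> unit_cube \<subseteq> U" and aX: "a \<in> unit_cube"
    using U a unfolding openin_contains_ball by blast
  \<comment> \<open>The box has side \<open>2 / k\<close>, so \<open>CARD('n) * (2 / k)\<close>
    bounds the l1 norm of \<open>x - a\<close> for \<open>x\<close> in the box; it must stay below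
    \<open>e\<close>.\<close>
  obtain k :: nat where k: "2 * CARD('n) / e < k" using reals_Archimedean2 by blast
  moreover have "0 \<le> 2 * CARD('n) / e" using e by simp
  ultimately have k0: "0 < real k" by linarith
  \<comment> \<open>Ceiling minus one instead of the floor: \<open>k * a $ i - j i\<close> has to be
    positive even when \<open>k * a $ i\<close> is an integer. It is at most 1, so the upper bound 2
    is strict as well.\<close>
  define j where "j i = \<lceil>real k * a $ i\<rceil> - 1" for i
  define p :: "'n \<times> bool \<Rightarrow> real ^ 'n \<Rightarrow> real" where "p = (\<lambda>(i, s) x. min 1 (max 0 (if s
    then of_int (int k) * x $ i + of_int (- j i) else of_int (- int k) * x $ i + of_int (j i + 2))))"
  have p: "p z \<in> mcn" for z
  proof (cases z)
    case (Pair i s)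
    show ?thesis
      unfolding Pair p_def by (cases s) (simp_all only: prod.case if_True if_False
          clip_affine_mcn[OF int_affine_coord])
  qed
  obtain h where h: "h \<in> mcn" and "mcn.supp h = unit_cube \<inter> (\<Inter>z\<in>UNIV. mcn.supp (p z))"
    using mcn.supp_Inter[of "UNIV :: ('n \<times> bool) set" p] p by auto
  moreover have "0 < p (i, True) x \<longleftrightarrow> 0 < k * x $ i - j i"
    "0 < p (i, False) x \<longleftrightarrow> k * x $ i - j i < 2" for i x
    by (auto simp: p_def max_def min_def)
  ultimately have supp_h: "x \<in> mcn.supp h \<longleftrightarrow> x \<in> unit_cube \<and>
      (\<forall>i. 0 < k * x $ i - j i \<and> k * x $ i - j i < 2)" for x
    by (auto simp: mcn.supp_def all_bool_eq)
  have aj: "0 < k * a $ i - j i \<and> k * a $ i - j i \<le> 1" for i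
    unfolding j_def by linarith
  have "a \<in> mcn.supp h"
    unfolding supp_h using aX aj by (smt (verit))
  moreover have "mcn.supp h \<subseteq> U"
  proof
    fix x assume "x \<in> mcn.supp h"
    then have x: "x \<in> unit_cube" "\<And>i. 0 < k * x $ i - j i \<and> k * x $ i - j i < 2"
      unfolding supp_h by auto
    have "\<bar>(x - a) $ i\<bar> \<le> 2 / k" for i
    proof -
      have "\<bar>k * (x $ i - a $ i)\<bar> \<le> 2"
        using x(2)[of i] aj[of i] unfolding right_diff_distrib by linarith
      then have "k * \<bar>x $ i - a $ i\<bar> \<le> 2" by (simp only: abs_mult abs_of_nat)
      then show ?thesis using k0 by (simp add: pos_le_divide_eq mult.commute)
    qed
    then have "norm (x - a) \<le> (\<Sum>i\<in>(UNIV :: 'n set). 2 / k)"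
      by (intro order_trans[OF norm_le_l1_cart] sum_mono)
    also have "\<dots> < e" using k k0 e by (simp add: field_simps)
    finally show "x \<in> U" using e x by (auto simp: dist_norm norm_minus_commute)
  qed
  ultimately show ?thesis using h by blast
qed


section \<open>States and measures\<close>

text \<open>Composing with \<open>restrict\<close> carries \<open>s\<close> over to functions with
  arbitrary values off the cube. The condition \<open>f + g \<le> 1\<close> on the cube makes the MV
  product zero and the truncation in the MV sum inactive.\<close>

lemma mv_functional_state:
  fixes s :: "(real ^ 'n \<Rightarrow> real) \<Rightarrow> real"
  assumes s: "mv_state free_mv s"
  shows "mv_functional unit_cube mcn (\<lambda>f. s (restrict f unit_cube))"
proof
  fix f g :: "real ^ 'n \<Rightarrow> real"
  show "(\<And>x. x \<in> unit_cube \<Longrightarrow> f x = g x) \<Longrightarrow> s (restrict f unit_cube) = s (restrict g unit_cube)"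
    by (metis restrict_ext)
  show "s (\<lambda>x\<in>unit_cube. 1) = 1"
    using s by (simp add: mv_state_def mv_one_free_mv)
  assume f: "f \<in> mcn"
  show "0 \<le> s (restrict f unit_cube)"
    using s f by (auto simp: mv_state_def free_mv_def mcn_def PiE_iff)
  assume g: "g \<in> mcn" and le: "\<And>x. x \<in> unit_cube \<Longrightarrow> f x + g x \<le> 1"
  let ?f = "restrict f unit_cube" and ?g = "restrict g unit_cube"
  have "mv_odot free_mv ?f ?g = mv_zero free_mv"
    using le unfolding mv_odot_free_mv by (auto simp: free_mv_def fun_eq_iff)
  moreover have "?f \<in> mv_carrier free_mv" "?g \<in> mv_carrier free_mv"
    using f g by (simp_all add: mcn_def free_mv_def)
  ultimately have "s (mv_oplus free_mv ?f ?g) = s ?f + s ?g"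
    using s unfolding mv_state_def by blast
  moreover have "mv_oplus free_mv ?f ?g = (\<lambda>x\<in>unit_cube. f x + g x)"
    using le by (auto simp: free_mv_def fun_eq_iff)
  ultimately show "s (\<lambda>x\<in>unit_cube. f x + g x) = s ?f + s ?g" by simp
qed

section \<open>Existence, uniqueness and regularity of representing measures\<close>

lemma sets_eq_supp_sigma: "borel_measure_on unit_cube M \<Longrightarrow> sets M = mcn.supp_sigma"
  by (simp add: borel_measure_on_def mcn_supp_sigma)

lemma state_representable:
  fixes s :: "(real ^ 'n \<Rightarrow> real) \<Rightarrow> real"
  assumes s: "mv_state free_mv s"
  shows "\<exists>M. borel_measure_on unit_cube M \<and> prob_space M \<and> represents M s"
proof -
  interpret S: mv_functional unit_cube mcn "\<lambda>f. s (restrict f unit_cube)"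
    by (rule mv_functional_state[OF s])
  have "borel_measure_on unit_cube S.rep_measure"
    using S.sets_rep_measure by (simp add: borel_measure_on_def mcn_supp_sigma)
  moreover have "represents S.rep_measure s"
    unfolding represents_def
  proof
    fix f :: "real ^ 'n \<Rightarrow> real" assume "f \<in> mv_carrier free_mv"
    then have "f \<in> mcnaughton" by (simp add: free_mv_def)
    from S.integral_rep_measure[OF mcnaughton_imp_mcn(1)[OF this]] mcnaughton_imp_mcn(2)[OF this]
    show "s f = (\<integral>x. f x \<partial>S.rep_measure)" by simp
  qed
  ultimately show ?thesis using S.prob_space_rep_measure by blast
qed

lemma representing_measure_unique:
  fixes M N :: "(real ^ 'n) measure"
  assumes M: "borel_measure_on unit_cube M" "prob_space M" "represents M s"
    and N: "borel_measure_on unit_cube N" "prob_space N" "represents N s"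
  shows "M = N"
proof (rule mcn.measure_eqI_integral)
  show sM: "sets M = mcn.supp_sigma" and sN: "sets N = mcn.supp_sigma"
    using M N by (simp_all only: sets_eq_supp_sigma)
  show "finite_measure M" "finite_measure N"
    using M N by (auto simp: prob_space_def)
  fix f :: "real ^ 'n \<Rightarrow> real" assume "f \<in> mcn"
  then have "restrict f unit_cube \<in> mv_carrier free_mv"
    by (simp add: mcn_def free_mv_def)
  then have "integral\<^sup>L M (restrict f unit_cube) = integral\<^sup>L N (restrict f unit_cube)"
    using M(3) N(3) unfolding represents_def by metis
  moreover have "integral\<^sup>L K (restrict f unit_cube) = (\<integral>x. f x \<partial>K)"
    if "sets K = mcn.supp_sigma" for K
    by (rule Bochner_Integration.integral_cong) (simp_all add: mcn.space_eq[OF that])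
  ultimately show "(\<integral>x. f x \<partial>M) = (\<integral>x. f x \<partial>N)" using sM sN by simp
qed

text \<open>Pushing \<open>M\<close> forward along the inclusion gives a finite Borel measure on the
  whole Polish space, where regularity is known. Compact subsets of \<open>B\<close> already lie in
  \<open>X\<close>, and an open \<open>U\<close> is cut down to \<open>U \<inter> X\<close>.\<close>

lemma regular_on_borel_measure:
  fixes X :: "'a::polish_space set"
  assumes X: "X \<in> sets borel" and M: "borel_measure_on X M" "finite_measure M"
  shows "regular_on X M"
  unfolding regular_on_def
proof (intro ballI conjI antisym)
  have sM: "sets M = sets (restrict_space borel X)" using M(1) by (simp add: borel_measure_on_def)
  then have sp: "space M = X" using sets_eq_imp_space_eq[OF sM] by (simp add: space_restrict_space)
  have sM_iff: "A \<in> sets M \<longleftrightarrow> A \<in> sets borel \<and> A \<subseteq> X" for A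
    using X by (auto simp: sM sets_restrict_space_iff)
  have id: "(\<lambda>x. x) \<in> measurable M borel"
    using measurable_restrict_space1[of "\<lambda>x. x" borel borel X]
    by (simp add: measurable_cong_sets[OF sM refl])
  define N where "N = distr M borel (\<lambda>x. x)"
  have N: "emeasure N A = emeasure M (A \<inter> X)" if "A \<in> sets borel" for A
    using that id by (simp add: N_def emeasure_distr sp)
  have sN: "sets N = sets borel" by (simp add: N_def)
  have fin: "emeasure N (space N) \<noteq> \<infinity>"
    using M(2) N[of UNIV] by (simp add: N_def finite_measure.emeasure_finite)
  fix B assume B: "B \<in> sets M"
  then have BX: "B \<in> sets borel" "B \<subseteq> X" by (auto simp: sM_iff)
  have NB: "emeasure N B = emeasure M B" using N[OF BX(1)] BX(2) by (simp add: Int_absorb2)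
  have "emeasure M B = (SUP K\<in>{K. K \<subseteq> B \<and> compact K}. emeasure N K)"
    using inner_regular[OF sN fin BX(1)] by (simp add: NB)
  also have "\<dots> = (SUP K\<in>{K. compact K \<and> K \<subseteq> B}. emeasure M K)"
    using BX(2) by (intro SUP_cong) (auto simp: N borel_compact Int_absorb2)
  finally have inner: "emeasure M B = (SUP K\<in>{K. compact K \<and> K \<subseteq> B}. emeasure M K)" .
  then show "emeasure M B \<le> (SUP K\<in>{K. compact K \<and> K \<subseteq> B}. emeasure M K)"
    and "(SUP K\<in>{K. compact K \<and> K \<subseteq> B}. emeasure M K) \<le> emeasure M B" by simp_all
  show "emeasure M B \<le> (INF U\<in>{U. openin (top_of_set X) U \<and> B \<subseteq> U}. emeasure M U)"
    using X by (intro INF_greatest emeasure_mono) (auto simp: sM_iff openin_open)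
  have "(INF U\<in>{U. openin (top_of_set X) U \<and> B \<subseteq> U}. emeasure M U) \<le>
      (INF U\<in>{U. B \<subseteq> U \<and> open U}. emeasure N U)"
  proof (rule INF_greatest)
    fix U assume "U \<in> {U. B \<subseteq> U \<and> open U}"
    then have U: "B \<subseteq> U" "open U" by auto
    then have "emeasure N U = emeasure M (U \<inter> X)" by (intro N) simp
    then show "(INF U\<in>{U. openin (top_of_set X) U \<and> B \<subseteq> U}. emeasure M U) \<le> emeasure N U"
      using U BX(2) by (intro INF_lower2[of "U \<inter> X"]) (auto simp: openin_open)
  qed
  also have "\<dots> = emeasure M B"
    using outer_regular[OF sN fin BX(1)] by (simp add: NB)
  finally show "(INF U\<in>{U. openin (top_of_set X) U \<and> B \<subseteq> U}. emeasure M U) \<le> emeasure M B" .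
qed

text \<open>A nonempty open set contains the positivity set of some McNaughton function that is not
  identically 0 on the cube; were the open set null, the integral of this function would vanish.
  Conversely, a nonnegative function of integral zero vanishes almost everywhere, so its open
  positivity set is null and hence empty.\<close>

lemma faithful_iff_strictly_positive:
  fixes M :: "(real ^ 'n) measure"
  assumes M: "borel_measure_on unit_cube M" "prob_space M"
    and rep: "represents M s" and s: "mv_state free_mv s"
  shows "faithful_mv_state free_mv s \<longleftrightarrow> strictly_positive_on unit_cube M"
proof
  note sM = sets_eq_supp_sigma[OF M(1)]
  note sp = mcn.space_eq[OF sM]
  have fin: "finite_measure M" using M(2) by (simp add: prob_space_def)
  {
    assume faithful: "faithful_mv_state free_mv s"
    show "strictly_positive_on unit_cube M"
      unfolding strictly_positive_on_def
    proof (intro allI impI, elim conjE)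
      fix U :: "(real ^ 'n) set"
      assume U: "openin (top_of_set unit_cube) U" "U \<noteq> {}"
      then obtain a where "a \<in> U" by blast
      then obtain f where f: "f \<in> mcn" "a \<in> mcn.supp f" "mcn.supp f \<subseteq> U"
        using mcn_bump[OF U(1)] by blast
      have UM: "U \<in> sets M"
        using U(1) M(1) by (auto simp: borel_measure_on_def sets_restrict_space openin_open)
      let ?f = "restrict f unit_cube"
      have f': "?f \<in> mcnaughton" using f(1) by (simp add: mcn_def)
      have "?f a \<noteq> mv_zero free_mv a"
        using f(2) by (simp add: mcn.supp_def free_mv_def)
      then have "?f \<noteq> mv_zero free_mv" by metis
      then have "(\<integral>x. ?f x \<partial>M) \<noteq> 0"
        using faithful rep f' by (auto simp: faithful_mv_state_def represents_def free_mv_def)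
      moreover have "(\<integral>x. ?f x \<partial>M) = 0" if "emeasure M U = 0"
      proof (rule integral_eq_zero_AE)
        have "{x \<in> space M. ?f x \<noteq> 0} \<subseteq> U"
          using f(3) mcn.nonneg[OF f(1)] by (force simp: sp mcn.supp_def)
        then show "AE x in M. ?f x = 0"
          using UM that by (intro AE_I'[of U]) auto
      qed
      ultimately show "0 < emeasure M U" by (auto simp: zero_less_iff_neq_zero)
    qed
  next
    assume pos: "strictly_positive_on unit_cube M"
    show "faithful_mv_state free_mv s"
      unfolding faithful_mv_state_def
    proof (intro conjI s ballI impI notI)
      fix f :: "real ^ 'n \<Rightarrow> real"
      assume f: "f \<in> mv_carrier free_mv" and ne: "f \<noteq> mv_zero free_mv" and "s f = 0"
      then have f': "f \<in> mcnaughton" and "(\<integral>x. f x \<partial>M) = 0"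
        using rep by (auto simp: represents_def free_mv_def)
      note fm = mcnaughton_imp_mcn[OF f']
      have "\<exists>x\<in>unit_cube. f x \<noteq> 0"
        using ne fm(2) by (metis (no_types, lifting) free_mv_def mv_alg.select_convs(4) restrict_ext)
      then have "mcn.supp f \<noteq> {}"
        using mcn.nonneg[OF fm(1)] by (force simp: mcn.supp_def)
      then have "0 < emeasure M (mcn.supp f)"
        using pos mcn.openin_supp[OF fm(1)] by (auto simp: strictly_positive_on_def)
      moreover have "AE x in M. f x = 0"
        using \<open>(\<integral>x. f x \<partial>M) = 0\<close> mcn.integrable_L[OF sM fm(1) fin] mcn.nonneg[OF fm(1)]
        by (subst integral_nonneg_eq_0_iff_AE[symmetric]) (auto simp: sp intro!: AE_I2)
      moreover have "{x \<in> space M. \<not> f x = 0} = mcn.supp f"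
        using mcn.nonneg[OF fm(1)] by (force simp: sp mcn.supp_def)
      ultimately show False
        using AE_iff_measurable[OF mcn.supp_in_sets[OF sM fm(1)], of "\<lambda>x. f x = 0"] by simp
    qed
  }
qed

text \<open>Supplies the preimages for surjectivity of \<open>state_measure\<close>. The integral is
  restricted to \<open>mcnaughton\<close> because states are extensional.\<close>

lemma integral_state:
  fixes M :: "(real ^ 'n) measure"
  assumes M: "borel_measure_on unit_cube M" "prob_space M"
  shows "mv_state free_mv (\<lambda>f\<in>mcnaughton. \<integral>x. f x \<partial>M)" (is "mv_state _ ?s")
  unfolding mv_state_def
proof (intro conjI ballI impI)
  interpret prob_space M by (rule M(2))
  note sM = sets_eq_supp_sigma[OF M(1)]
  note sp = mcn.space_eq[OF sM]
  have int: "integrable M f" if "f \<in> mcnaughton" for f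
    by (rule mcn.integrable_L[OF sM mcnaughton_imp_mcn(1)[OF that] finite_measure_axioms])
  have bnd: "0 \<le> f x \<and> f x \<le> 1" if "f \<in> mcnaughton" "x \<in> space M" for f x
    using mcn.nonneg mcn.le_one mcnaughton_imp_mcn(1)[OF that(1)] that(2) sp by blast
  have "(\<integral>x. f x \<partial>M) \<le> (\<integral>x. 1 \<partial>M)" if "f \<in> mcnaughton" for f
    by (rule integral_mono[OF int[OF that]]) (use bnd[OF that] in auto)
  then have "(\<integral>x. f x \<partial>M) \<in> {0..1}" if "f \<in> mcnaughton" for f
    using that bnd[OF that] by (auto intro!: Bochner_Integration.integral_nonneg simp: prob_space)
  then show "?s \<in> mv_carrier free_mv \<rightarrow>\<^sub>E {0..1}"
    by (auto simp: free_mv_def)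
  have "(\<lambda>x\<in>unit_cube. 1 :: real) \<in> (mcnaughton :: (real ^ 'n \<Rightarrow> real) set)"
    using mcn.one by (simp add: mcn_def)
  moreover have "integral\<^sup>L M (\<lambda>x\<in>unit_cube. 1 :: real) = (\<integral>x. 1 \<partial>M)"
    by (rule Bochner_Integration.integral_cong) (auto simp: sp)
  ultimately show "?s (mv_one free_mv) = 1"
    by (simp only: mv_one_free_mv restrict_apply') (simp add: prob_space)
  fix f g :: "real ^ 'n \<Rightarrow> real"
  assume "f \<in> mv_carrier free_mv" "g \<in> mv_carrier free_mv"
    and odot: "mv_odot free_mv f g = mv_zero free_mv"
  then have f: "f \<in> mcnaughton" and g: "g \<in> mcnaughton" by (simp_all add: free_mv_def)
  have le: "f x + g x \<le> 1" if "x \<in> unit_cube" for x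
    using fun_cong[OF odot, of x] that unfolding mv_odot_free_mv by (simp add: free_mv_def max_def split: if_splits)
  have "integral\<^sup>L M (\<lambda>x\<in>unit_cube. min 1 (f x + g x)) = (\<integral>x. f x + g x \<partial>M)"
    by (rule Bochner_Integration.integral_cong) (auto simp: sp min_absorb2 le)
  then show "?s (mv_oplus free_mv f g) = ?s f + ?s g"
    using f g mcnaughton_oplus[OF f g] by (simp add: free_mv_def int)
qed

theorem proposition4p2:
  shows "(\<forall>s :: (real ^ 'n \<Rightarrow> real) \<Rightarrow> real. mv_state free_mv s \<longrightarrow>
      (faithful_mv_state free_mv s \<longleftrightarrow>
       (\<exists>!M. M \<in> strictly_positive_prob_measures \<and> represents M s))) \<and>
    bij_betw (state_measure :: ((real ^ 'n \<Rightarrow> real) \<Rightarrow> real) \<Rightarrow> (real ^ 'n) measure)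
      {s. faithful_mv_state free_mv s} strictly_positive_prob_measures"
proof
  \<comment> \<open>Membership in \<open>strictly_positive_prob_measures\<close> includes
    regularity, which \<open>state_representable\<close> does not state.\<close>
  have regular: "regular_on unit_cube M"
    if "borel_measure_on unit_cube M" "prob_space M" for M :: "(real ^ 'n) measure"
    using that by (intro regular_on_borel_measure) (auto simp: prob_space_def)
  have unique: "M = N" if "M \<in> strictly_positive_prob_measures" "represents M s"
    "N \<in> strictly_positive_prob_measures" "represents N s"
    for M N and s :: "(real ^ 'n \<Rightarrow> real) \<Rightarrow> real"
    using that representing_measure_unique by (auto simp: strictly_positive_prob_measures_def)
  have faithful_if: "faithful_mv_state free_mv s"
    if "M \<in> strictly_positive_prob_measures" "represents M s" "mv_state free_mv s"
    for M and s :: "(real ^ 'n \<Rightarrow> real) \<Rightarrow> real"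
    using that faithful_iff_strictly_positive by (auto simp: strictly_positive_prob_measures_def)
  have ex: "\<exists>M. M \<in> strictly_positive_prob_measures \<and> represents M s"
    if s: "faithful_mv_state free_mv s" for s :: "(real ^ 'n \<Rightarrow> real) \<Rightarrow> real"
  proof -
    have "mv_state free_mv s" using s by (simp add: faithful_mv_state_def)
    then obtain M where "borel_measure_on unit_cube M" "prob_space M" "represents M s"
      using state_representable by blast
    then show ?thesis
      using s regular faithful_iff_strictly_positive \<open>mv_state free_mv s\<close>
      by (auto simp: strictly_positive_prob_measures_def)
  qed
  show "\<forall>s :: (real ^ 'n \<Rightarrow> real) \<Rightarrow> real. mv_state free_mv s \<longrightarrow>
      (faithful_mv_state free_mv s \<longleftrightarrow>
       (\<exists>!M. M \<in> strictly_positive_prob_measures \<and> represents M s))"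
    using ex unique faithful_if by blast
  \<comment> \<open>Uniqueness lets the definite description be evaluated at any strictly positive
    representing measure.\<close>
  have eq: "state_measure s = M"
    if "M \<in> strictly_positive_prob_measures" "represents M s"
    for M and s :: "(real ^ 'n \<Rightarrow> real) \<Rightarrow> real"
    unfolding state_measure_def using that unique by (intro the_equality) auto
  show "bij_betw (state_measure :: ((real ^ 'n \<Rightarrow> real) \<Rightarrow> real) \<Rightarrow> (real ^ 'n) measure)
      {s. faithful_mv_state free_mv s} strictly_positive_prob_measures"
  proof (rule bij_betw_imageI)
    show "inj_on state_measure {s :: (real ^ 'n \<Rightarrow> real) \<Rightarrow> real. faithful_mv_state free_mv s}"
    proof (rule inj_onI, safe)
      fix s t :: "(real ^ 'n \<Rightarrow> real) \<Rightarrow> real"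
      assume s: "faithful_mv_state free_mv s" and t: "faithful_mv_state free_mv t"
        and "state_measure s = state_measure t"
      \<comment> \<open>One measure represents both states, so they agree on the carrier; off it
        both are \<open>undefined\<close>.\<close>
      then obtain M where "represents M s" "represents M t"
        using ex[OF s] ex[OF t] eq by metis
      moreover have "s \<in> extensional (mv_carrier free_mv)" "t \<in> extensional (mv_carrier free_mv)"
        using s t by (auto simp: faithful_mv_state_def mv_state_def PiE_def)
      ultimately show "s = t"
        by (auto simp: represents_def intro: extensionalityI)
    qed
    show "state_measure ` {s. faithful_mv_state free_mv s} =
      (strictly_positive_prob_measures :: (real ^ 'n) measure set)"
    proof (intro equalityI subsetI)
      fix M :: "(real ^ 'n) measure"
      assume "M \<in> state_measure ` {s. faithful_mv_state free_mv s}"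
      then show "M \<in> strictly_positive_prob_measures" using ex eq by blast
    next
      fix M :: "(real ^ 'n) measure" assume M: "M \<in> strictly_positive_prob_measures"
      let ?s = "\<lambda>f\<in>mcnaughton. \<integral>x. f x \<partial>M"
      have "mv_state free_mv ?s"
        using M integral_state by (auto simp: strictly_positive_prob_measures_def)
      moreover have "represents M ?s" by (simp add: represents_def free_mv_def)
      ultimately show "M \<in> state_measure ` {s. faithful_mv_state free_mv s}"
        using faithful_if[OF M] eq[OF M] by force
    qed
  qed
qed

end
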